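(* Let $k\in\{0,1,2,\dots\}\cup\{\infty\}$. Then each of the classes $U_2(T,k)$, $U_3(T,k)$, $U_4(T,k)$, $U_5(T,k)$ is a dense $G_\delta$ subset of $C^k(T)$.
   Context: $D=\{|z|<1\}$, $T=\{|z|=1\}$, $D(z_0,r)$ the open disk of center $z_0$ and radius $r$. For $k\in\{0,1,2,\dots\}\cup\{\infty\}$, $C^k(T)$ is the space of $u:T\to\mathbb{C}$ such that $\theta\mapsto u(e^{i\theta})$ is $k$ times continuously differentiable on $\mathbb{R}$, with the topology given by the seminorms $\sup_{\theta\in\mathbb{R}}|\frac{d^l}{d\theta^l}u(e^{i\theta})|$ for all integers $0\le l\le k$. For $z_0\in T$, $r>0$ let $\Omega(z_0,r)=D(z_0,r)\cap\{|z|>1\}$ and $P(z_0,r)=D(z_0,r)\cap D$. $U_2(T,z_0,k)$: the $u\in C^k(T)$ for which there exist no $r>0$ and no continuous $\lambda:T\cup\Omega(z_0,r)\to\mathbb{C}$ holomorphic on $\Omega(z_0,r)$ with $\lambda=u$ on $D(z_0,r)\cap T$. $U_3(T,z_0,k)$: the same with $P(z_0,r)$ in place of $\Omega(z_0,r)$. $U_4(T,z_0,k)=U_2(T,z_0,k)\cap U_3(T,z_0,k)$. $U_5(T,z_0,k)$: the $u\in C^k(T)$ for which there exist no $r>0$ and no holomorphic $F:D(z_0,r)\to\mathbb{C}$ with $F=u$ on $D(z_0,r)\cap T$. Finally $U_j(T,k)=\bigcap_{z_0\in T}U_j(T,z_0,k)$ for $j=2,3,4,5$. *)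

theory Defs
  imports "HOL-Analysis.Analysis" "HOL-Library.Extended_Nat"
begin

text \<open>A function u on the unit circle T is represented by g(theta) = u(e^{i theta}),
  a 2pi-periodic function from the reals to the complex numbers.\<close>

fun dtheta :: "nat \<Rightarrow> (real \<Rightarrow> complex) \<Rightarrow> real \<Rightarrow> complex" where
  "dtheta 0 g = g"
| "dtheta (Suc l) g = (\<lambda>x. vector_derivative (dtheta l g) (at x))"

definition Ck :: "enat \<Rightarrow> (real \<Rightarrow> complex) set" where
  "Ck k = {g. (\<forall>\<theta>. g (\<theta> + 2 * pi) = g \<theta>)
              \<and> (\<forall>l. enat l \<le> k \<longrightarrow> continuous_on UNIV (dtheta l g))
              \<and> (\<forall>l. enat (Suc l) \<le> k \<longrightarrow> (\<forall>x. dtheta l g differentiable (at x)))}"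

definition Ck_topology :: "enat \<Rightarrow> (real \<Rightarrow> complex) topology" where
  "Ck_topology k = subtopology
     (topology_generated_by
       {{g \<in> Ck k. (SUP \<theta>. norm (dtheta l g \<theta> - dtheta l f \<theta>)) < \<epsilon>}
          | f l \<epsilon>. f \<in> Ck k \<and> enat l \<le> k \<and> \<epsilon> > 0})
     (Ck k)"

definition Omega :: "complex \<Rightarrow> real \<Rightarrow> complex set" where
  "Omega z0 r = ball z0 r \<inter> {z. norm z > 1}"

definition Pdisk :: "complex \<Rightarrow> real \<Rightarrow> complex set" where
  "Pdisk z0 r = ball z0 r \<inter> ball 0 1"

definition agrees_on_arc :: "(complex \<Rightarrow> complex) \<Rightarrow> (real \<Rightarrow> complex) \<Rightarrow> complex \<Rightarrow> real \<Rightarrow> bool" where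
  "agrees_on_arc F g z0 r \<longleftrightarrow> (\<forall>\<theta>. cis \<theta> \<in> ball z0 r \<longrightarrow> F (cis \<theta>) = g \<theta>)"

definition U2_at :: "enat \<Rightarrow> complex \<Rightarrow> (real \<Rightarrow> complex) set" where
  "U2_at k z0 = {g \<in> Ck k. \<not> (\<exists>r>0. \<exists>L.
       continuous_on (sphere 0 1 \<union> Omega z0 r) L \<and> L holomorphic_on Omega z0 r
       \<and> agrees_on_arc L g z0 r)}"

definition U3_at :: "enat \<Rightarrow> complex \<Rightarrow> (real \<Rightarrow> complex) set" where
  "U3_at k z0 = {g \<in> Ck k. \<not> (\<exists>r>0. \<exists>L.
       continuous_on (sphere 0 1 \<union> Pdisk z0 r) L \<and> L holomorphic_on Pdisk z0 r
       \<and> agrees_on_arc L g z0 r)}"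

definition U4_at :: "enat \<Rightarrow> complex \<Rightarrow> (real \<Rightarrow> complex) set" where
  "U4_at k z0 = U2_at k z0 \<inter> U3_at k z0"

definition U5_at :: "enat \<Rightarrow> complex \<Rightarrow> (real \<Rightarrow> complex) set" where
  "U5_at k z0 = {g \<in> Ck k. \<not> (\<exists>r>0. \<exists>F.
       F holomorphic_on ball z0 r \<and> agrees_on_arc F g z0 r)}"

definition U2 :: "enat \<Rightarrow> (real \<Rightarrow> complex) set" where
  "U2 k = (\<Inter>z0\<in>sphere 0 1. U2_at k z0)"
definition U3 :: "enat \<Rightarrow> (real \<Rightarrow> complex) set" where
  "U3 k = (\<Inter>z0\<in>sphere 0 1. U3_at k z0)"
definition U4 :: "enat \<Rightarrow> (real \<Rightarrow> complex) set" where
  "U4 k = (\<Inter>z0\<in>sphere 0 1. U4_at k z0)"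
definition U5 :: "enat \<Rightarrow> (real \<Rightarrow> complex) set" where
  "U5 k = (\<Inter>z0\<in>sphere 0 1. U5_at k z0)"

definition dense_gdelta_in :: "'a topology \<Rightarrow> 'a set \<Rightarrow> bool" where
  "dense_gdelta_in X S \<longleftrightarrow> gdelta_in X S \<and> X closure_of S = topspace X"

end

theory Submission
  imports Defs "HOL-Complex_Analysis.Complex_Analysis" "HOL-Real_Asymp.Real_Asymp"
begin

text \<open>
  By the jump relation for Cauchy integrals, \<open>u\<close> extends holomorphically to the inner side of an arc
  around \<open>z0\<close> iff its exterior Cauchy transform continues analytically across that arc, i.e. iff the
  Taylor coefficients of this transform at \<open>2 z0\<close> decay like \<open>(1 + s)\<^sup>-\<^sup>n\<close> for some \<open>s > 0\<close>. Each
  coefficient is continuous in \<open>u\<close>, so a bound with fixed constants is a closed condition, and it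
  suffices to consider \<open>z0\<close> in a countable dense set. The outer side is reduced to the inner one
  by \<open>z \<mapsto> 1/z\<close>, and \<open>u\<close> extends to a full neighbourhood iff it extends to both sides.

  Density needs no Baire argument. The functions extending near a given point form a linear space,
  so if \<open>h\<close> lies in none of the countably many spaces in question, then \<open>f + t h\<close> avoids all of them
  for all but countably many real \<open>t\<close>. Such an \<open>h\<close> is \<open>\<Sum>\<^sub>j 2^(-j^2) cos(2\<^sup>j \<theta>)\<close>, whose Taylor coefficients
  at dyadic points can be computed and do not decay geometrically.
\<close>

section \<open>Taylor coefficients of the exterior Cauchy transform\<close>

text \<open>An extension comes with no control of its radius or its size, so closedness of the
  extendable functions would call for normal families. The numbers \<open>taylor2 n g\<close> avoid
  this: they are integrals of the boundary values alone and exist for every continuous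
  \<open>g\<close>. The centre 2 (for the base point 1) is at distance 1 from the circle, and 1 is
  the only nearest point; a radius of convergence \<open>1 + s\<close> therefore reaches past the
  circle exactly around 1.

  For merely continuous \<open>g\<close> a single Cauchy transform may have no boundary limits. The
  jump is therefore taken between \<open>z\<close> and its mirror point \<open>1 / cnj z\<close>,
  where the two kernels combine to the Poisson kernel. Since dw = i w dt,
  \<open>cauchy_transform\<close> is \<open>2 * pi\<close> times the usual Cauchy integral, which
  explains the later factors \<open>2 * pi\<close>.

  One proof serves all \<open>k\<close>: openness is seen by the sup seminorm alone, which is
  present for every \<open>k\<close>, and the exceptional function is smooth. It is built from
  cosines because the exterior transform sees only negative frequencies, and these must be present
  before and after reflection.\<close>

definition cauchy_transform :: "(real \<Rightarrow> complex) \<Rightarrow> complex \<Rightarrow> complex" where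
  "cauchy_transform g z = integral {-pi..pi} (\<lambda>t. g t * cis t / (cis t - z))"

text \<open>Up to the factor \<open>2\<pi>\<close>, the Taylor coefficients at the point 2 of the Cauchy transform.\<close>

definition taylor2 :: "nat \<Rightarrow> (real \<Rightarrow> complex) \<Rightarrow> complex" where
  "taylor2 n g = integral {-pi..pi} (\<lambda>t. g t * cis t / (cis t - 2) ^ Suc n)"

definition geometric_bound :: "real \<Rightarrow> real \<Rightarrow> (real \<Rightarrow> complex) \<Rightarrow> bool" where
  "geometric_bound s M g \<longleftrightarrow> (\<forall>n. norm (taylor2 n g) * (1 + s) ^ n \<le> M)"

lemma norm_cis_minus_2_ge: "2 - cos t \<le> norm (cis t - 2)"
  using abs_Re_le_cmod[of "cis t - 2"] by auto

lemma norm_cis_minus_2_ge_1: "1 \<le> norm (cis t - 2)"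
  using norm_cis_minus_2_ge[of t] cos_le_one[of t] by linarith

lemma cis_neq_2 [simp]: "cis t \<noteq> 2" "2 \<noteq> cis t"
  using norm_cis_minus_2_ge_1[of t] by auto

lemma continuous_on_taylor2_integrand:
  assumes "continuous_on S g"
  shows "continuous_on S (\<lambda>t. g t * cis t / (cis t - 2) ^ n)"
  using assms by (intro continuous_intros) auto

lemma taylor2_integrable:
  assumes "continuous_on {a..b} g"
  shows "(\<lambda>t. g t * cis t / (cis t - 2) ^ n) integrable_on {a..b}"
  using assms by (intro integrable_continuous_real continuous_on_taylor2_integrand)

lemma taylor2_add:
  assumes "continuous_on UNIV f" "continuous_on UNIV g"
  shows "taylor2 n (\<lambda>t. f t + c * g t) = taylor2 n f + c * taylor2 n g"
proof -
  have *: "(\<lambda>t. (f t + c * g t) * cis t / (cis t - 2) ^ Suc n) =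
     (\<lambda>t. f t * cis t / (cis t - 2) ^ Suc n + c * (g t * cis t / (cis t - 2) ^ Suc n))"
    by (auto simp: add_divide_distrib algebra_simps)
  have int: "(\<lambda>t. f t * cis t / (cis t - 2) ^ Suc n) integrable_on {-pi..pi}"
       "(\<lambda>t. g t * cis t / (cis t - 2) ^ Suc n) integrable_on {-pi..pi}"
    using assms by (auto intro!: taylor2_integrable intro: continuous_on_subset simp del: power_Suc)
  show ?thesis
    unfolding taylor2_def *
    using int integrable_on_mult_right[OF int(2), of c]
    by (subst integral_add) (simp_all only: integral_mult_right)
qed

text \<open>The circle stays at distance at least 1 from 2, so each coefficient is continuous in the
  sup norm, with one constant for all \<open>n\<close>. Openness of the failure of a bound and the
  passage to uniform limits both rest on this.\<close>

lemma norm_taylor2_le: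
  assumes "continuous_on UNIV g" "\<And>t. norm (g t) \<le> B"
  shows "norm (taylor2 n g) \<le> 2 * pi * B"
proof -
  have "0 \<le> B" using assms(2)[of 0] norm_ge_zero order_trans by blast
  have "norm (integral {-pi..pi} (\<lambda>t. g t * cis t / (cis t - 2) ^ Suc n)) \<le> B * (pi - -pi)"
  proof (rule integral_bound)
    fix t assume "t \<in> {-pi..pi}"
    have "1 \<le> norm (cis t - 2) ^ Suc n"
      using norm_cis_minus_2_ge_1 by (rule one_le_power)
    then show "norm (g t * cis t / (cis t - 2) ^ Suc n) \<le> B"
      using assms(2)[of t] \<open>0 \<le> B\<close>
      by (simp add: norm_mult norm_divide norm_power divide_le_eq del: power_Suc)
         (smt (verit, best) mult_le_cancel_left1)
  qed (use assms(1) in \<open>auto intro!: continuous_on_taylor2_integrand intro: continuous_on_subset simp del: power_Suc\<close>)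
  then show ?thesis by (simp add: taylor2_def algebra_simps)
qed

lemma geometric_bound_mono:
  assumes "geometric_bound s M g" "0 \<le> s'" "s' \<le> s" "M \<le> M'"
  shows "geometric_bound s' M' g"
  unfolding geometric_bound_def
proof
  fix n
  have "norm (taylor2 n g) * (1 + s') ^ n \<le> norm (taylor2 n g) * (1 + s) ^ n"
    using assms by (intro mult_left_mono power_mono) auto
  then show "norm (taylor2 n g) * (1 + s') ^ n \<le> M'"
    using assms(1,4) unfolding geometric_bound_def by (meson order_trans)
qed

lemma geometric_bound_add:
  assumes "continuous_on UNIV f" "continuous_on UNIV g" "geometric_bound s M f" "geometric_bound s N g" "0 \<le> s"
  shows "geometric_bound s (M + norm c * N) (\<lambda>t. f t + c * g t)"
  unfolding geometric_bound_def
proof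
  fix n
  have "norm (taylor2 n (\<lambda>t. f t + c * g t)) * (1 + s) ^ n
      \<le> (norm (taylor2 n f) + norm c * norm (taylor2 n g)) * (1 + s) ^ n"
    using assms by (intro mult_right_mono) (auto simp: taylor2_add norm_mult intro: norm_triangle_le)
  also have "\<dots> = norm (taylor2 n f) * (1 + s) ^ n + norm c * (norm (taylor2 n g) * (1 + s) ^ n)"
    by (simp add: algebra_simps)
  also have "\<dots> \<le> M + norm c * N"
    using assms(3,4) by (intro add_mono mult_left_mono) (auto simp: geometric_bound_def)
  finally show "norm (taylor2 n (\<lambda>t. f t + c * g t)) * (1 + s) ^ n \<le> M + norm c * N" .
qed

text \<open>The chord \<open>Re z = 1 - s\<close> is at distance exactly \<open>1 + s\<close> from
  2, which is where the \<open>s\<close> of \<open>geometric_bound\<close> comes from. The segment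
  is convex, so Cauchy's theorem applies to it directly.\<close>

definition cap :: "real \<Rightarrow> complex set" where
  "cap s = cball 0 1 \<inter> {z. 1 - s \<le> Re z}"

lemma convex_cap: "convex (cap s)"
  unfolding cap_def by (intro convex_Int convex_cball convex_halfspace_Re_ge)

lemma compact_cap: "compact (cap s)"
  unfolding cap_def by (intro compact_Int_closed compact_cball closed_halfspace_Re_ge)

lemma interior_cap: "interior (cap s) \<subseteq> ball 0 1"
  unfolding cap_def by (metis Int_lower1 interior_cball interior_mono)

lemma cap_norm_le:
  assumes "z \<in> cap s" 
  shows "norm (z - 1) ^ 2 \<le> 2 * s"
proof -
  have "norm z ^ 2 \<le> 1" using assms by (simp add: cap_def power_le_one)
  moreover have "norm (z - 1) ^ 2 = norm z ^ 2 + 1 - 2 * Re z"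
    unfolding cmod_power2 by (simp add: power2_eq_square algebra_simps)
  ultimately show ?thesis using assms by (simp add: cap_def)
qed

text \<open>Replacing the arc by its chord keeps the contour at distance at least \<open>1 + s\<close> from the point 2.\<close>

lemma extension_imp_geometric_bound:
  assumes g: "continuous_on UNIV g" and s: "0 < s" "s < 1"
    and L: "continuous_on (cap s) L" "L holomorphic_on interior (cap s)"
    and Lg: "\<And>t. 1 - s \<le> cos t \<Longrightarrow> L (cis t) = g t"
  shows "\<exists>M. geometric_bound s M g"
proof -
  define \<alpha> where "\<alpha> = arccos (1 - s)"
  have \<alpha>: "0 < \<alpha>" "\<alpha> < pi" "cos \<alpha> = 1 - s"
    using s arccos_lt_bounded[of "1 - s"] by (auto simp: \<alpha>_def)
  have cos_in: "1 - s \<le> cos t" if "t \<in> {-\<alpha>..\<alpha>}" for t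
    using that cos_monotone_0_pi_le[of "\<bar>t\<bar>" \<alpha>] \<alpha> by auto
  have cos_out: "cos t \<le> 1 - s" if "t \<in> {-pi..-\<alpha>} \<union> {\<alpha>..pi}" for t
    using that cos_monotone_0_pi_le[of \<alpha> "\<bar>t\<bar>"] \<alpha> by auto
  have "bounded (g ` {-pi..pi})"
    using g by (intro compact_imp_bounded compact_continuous_image) (auto intro: continuous_on_subset)
  then obtain B1 where B1: "0 < B1" "\<And>t. t \<in> {-pi..pi} \<Longrightarrow> norm (g t) \<le> B1"
    unfolding bounded_pos by auto
  have "bounded (L ` cap s)"
    using L compact_cap by (intro compact_imp_bounded compact_continuous_image) auto
  then obtain B2 where B2: "0 < B2" "\<And>z. z \<in> cap s \<Longrightarrow> norm (L z) \<le> B2"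
    unfolding bounded_pos by auto
  \<comment> \<open>The denominators have exponent \<open>Suc n\<close> and the weight only
    \<open>n\<close>; the spare factor \<open>norm y\<close> is at least 1 and is dropped.\<close>
  have powle: "norm (x / y ^ Suc n) * (1 + s) ^ n \<le> B"
    if "norm x \<le> B" "1 + s \<le> norm y" for x y :: complex and B n
  proof -
    have "(1 + s) ^ n \<le> (1 + s) ^ Suc n" using s by (intro power_increasing) auto
    also have "\<dots> \<le> norm y ^ Suc n" using that s by (intro power_mono) auto
    finally have "(1 + s) ^ n \<le> norm y ^ Suc n" .
    moreover have "0 < norm y" using that s by linarith
    moreover have "0 \<le> B" using that norm_ge_zero order_trans by blast
    ultimately show ?thesis using that s
      by (simp add: norm_divide norm_power divide_le_eq del: power_Suc) (intro mult_mono, auto)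
  qed
  have cis_cap: "cis t \<in> cap s" if "t \<in> {-\<alpha>..\<alpha>}" for t
    using cos_in[OF that] by (simp add: cap_def)
  let ?I = "\<lambda>n a b. integral {a..b} (\<lambda>t. g t * cis t / (cis t - 2) ^ Suc n)"
  have split: "taylor2 n g = ?I n (-pi) (-\<alpha>) + ?I n (-\<alpha>) \<alpha> + ?I n \<alpha> pi" for n
  proof -
    have int: "(\<lambda>t. g t * cis t / (cis t - 2) ^ Suc n) integrable_on {a..b}" for a b
      using g by (intro taylor2_integrable) (auto intro: continuous_on_subset)
    have "?I n (-pi) (-\<alpha>) + ?I n (-\<alpha>) \<alpha> = ?I n (-pi) \<alpha>" "?I n (-pi) \<alpha> + ?I n \<alpha> pi = ?I n (-pi) pi"
      using \<alpha> int by (intro Henstock_Kurzweil_Integration.integral_combine; simp del: power_Suc)+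
    then show ?thesis by (simp add: taylor2_def del: power_Suc)
  qed
  \<comment> \<open>Here \<open>cos t \<le> 1 - s\<close>, so the circle itself is at distance at
    least \<open>1 + s\<close> from 2 and boundedness of \<open>g\<close> suffices.\<close>
  have outer: "norm (?I n a b) * (1 + s) ^ n \<le> B1 * (b - a)"
    if ab: "a \<le> b" "{a..b} \<subseteq> {-pi..-\<alpha>} \<union> {\<alpha>..pi}" for n a b
  proof -
    have "norm (?I n a b) \<le> (B1 / (1 + s) ^ n) * (b - a)"
    proof (rule integral_bound)
      fix t assume t: "t \<in> {a..b}"
      then have "1 + s \<le> norm (cis t - 2)" "t \<in> {-pi..pi}"
        using cos_out[of t] norm_cis_minus_2_ge[of t] ab \<alpha> by force+
      then have "norm (g t * cis t / (cis t - 2) ^ Suc n) * (1 + s) ^ n \<le> B1"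
        using B1 by (intro powle) (auto simp: norm_mult)
      then show "norm (g t * cis t / (cis t - 2) ^ Suc n) \<le> B1 / (1 + s) ^ n"
        using s by (simp add: pos_le_divide_eq del: power_Suc)
    qed (use g ab in \<open>auto intro!: continuous_on_taylor2_integrand intro: continuous_on_subset simp del: power_Suc\<close>)
    then show ?thesis using s by (simp add: pos_le_divide_eq divide_simps)
  qed
  have middle: "norm (?I n (-\<alpha>) \<alpha>) * (1 + s) ^ n \<le> B2 * norm (cis \<alpha> - cis (-\<alpha>))" for n
  proof -
    let ?f = "\<lambda>w. L w / (w - 2) ^ Suc n"
    let ?arc = "part_circlepath 0 1 (-\<alpha>) \<alpha>" and ?chord = "linepath (cis \<alpha>) (cis (-\<alpha>))"
    have n2: "w \<noteq> 2" if "w \<in> cap s" for w using that by (auto simp: cap_def)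
    have contf: "continuous_on (cap s) ?f" using n2 by (intro continuous_intros L) auto
    have arc: "path_image ?arc \<subseteq> cap s"
      using \<alpha> cis_cap by (auto simp: path_image_part_circlepath cis_conv_exp)
    have chord: "path_image ?chord \<subseteq> cap s"
      using \<alpha> cis_cap convex_cap by (auto simp: closed_segment_subset)
    have "(?f has_contour_integral 0) (?arc +++ ?chord)"
    proof (rule Cauchy_theorem_convex[OF contf convex_cap finite.emptyI])
      show "?f field_differentiable at x" if "x \<in> interior (cap s) - {}" for x
      proof (rule holomorphic_on_imp_differentiable_at)
        show "?f holomorphic_on interior (cap s)"
          using L n2 interior_subset by (intro holomorphic_intros) auto
      qed (use that in auto)
      show "path_image (?arc +++ ?chord) \<subseteq> cap s"
        using arc chord by (intro subset_path_image_join)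
    qed (auto simp: cis_conv_exp intro!: valid_path_join)
    moreover have "?f contour_integrable_on ?arc" "?f contour_integrable_on ?chord"
      using contf arc chord
      by (auto intro!: contour_integrable_continuous_part_circlepath contour_integrable_continuous_linepath
               intro: continuous_on_subset simp del: power_Suc)
    ultimately have "contour_integral ?arc ?f + contour_integral ?chord ?f = 0"
      by (subst contour_integral_join[symmetric]) (auto simp: contour_integral_unique)
    moreover have "contour_integral ?arc ?f = \<i> * ?I n (-\<alpha>) \<alpha>"
    proof -
      have "contour_integral ?arc ?f = integral {-\<alpha>..\<alpha>} (\<lambda>t. ?f (cis t) * \<i> * cis t)"
        using \<alpha> by (subst contour_integral_part_circlepath_eq) auto
      also have "\<dots> = integral {-\<alpha>..\<alpha>} (\<lambda>t. \<i> * (g t * cis t / (cis t - 2) ^ Suc n))"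
        using Lg cos_in by (intro integral_cong) (simp del: power_Suc)
      finally show ?thesis by (simp only: integral_mult_right)
    qed
    moreover have "norm (contour_integral ?chord ?f) \<le> (B2 / (1 + s) ^ n) * norm (cis (-\<alpha>) - cis \<alpha>)"
    proof (rule contour_integral_bound_linepath)
      fix w assume w: "w \<in> closed_segment (cis \<alpha>) (cis (-\<alpha>))"
      then obtain u where "w = (1 - u) *\<^sub>R cis \<alpha> + u *\<^sub>R cis (-\<alpha>)" by (auto simp: closed_segment_def)
      then have "Re w = (1 - u) * (1 - s) + u * (1 - s)" using \<alpha>(3) by simp
      then have "Re w = 1 - s" by (simp add: algebra_simps)
      then have "1 + s \<le> norm (w - 2)" using abs_Re_le_cmod[of "w - 2"] s by auto
      then have "norm (?f w) * (1 + s) ^ n \<le> B2"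
        using B2(2)[of w] w chord by (intro powle) auto
      then show "norm (?f w) \<le> B2 / (1 + s) ^ n"
        using s by (simp add: pos_le_divide_eq del: power_Suc)
    qed (use \<open>?f contour_integrable_on ?chord\<close> B2 s in auto)
    ultimately have "norm (\<i> * ?I n (-\<alpha>) \<alpha>) \<le> (B2 / (1 + s) ^ n) * norm (cis (-\<alpha>) - cis \<alpha>)"
      by (metis add_eq_0_iff norm_minus_cancel)
    then show ?thesis using s
      by (simp add: norm_mult pos_le_divide_eq divide_simps norm_minus_commute del: power_Suc)
  qed
  have "norm (taylor2 n g) * (1 + s) ^ n
      \<le> B1 * (pi - \<alpha>) + B2 * norm (cis \<alpha> - cis (-\<alpha>)) + B1 * (pi - \<alpha>)" for n
  proof -
    have "norm (taylor2 n g) * (1 + s) ^ n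
       \<le> (norm (?I n (-pi) (-\<alpha>)) + norm (?I n (-\<alpha>) \<alpha>) + norm (?I n \<alpha> pi)) * (1 + s) ^ n"
      unfolding split using s by (intro mult_right_mono norm_triangle_mono order_refl) auto
    also have "\<dots> = norm (?I n (-pi) (-\<alpha>)) * (1 + s) ^ n + norm (?I n (-\<alpha>) \<alpha>) * (1 + s) ^ n
          + norm (?I n \<alpha> pi) * (1 + s) ^ n"
      by (simp add: algebra_simps)
    also have "\<dots> \<le> B1 * (-\<alpha> - -pi) + B2 * norm (cis \<alpha> - cis (-\<alpha>)) + B1 * (pi - \<alpha>)"
      using \<alpha> by (intro add_mono outer middle) auto
    finally show ?thesis by simp
  qed
  then show ?thesis unfolding geometric_bound_def by blast
qed

section \<open>Analytic continuation of the Cauchy transform\<close>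

lemma cauchy_transform_integrable:
  assumes "continuous_on UNIV g" "z \<notin> sphere 0 1"
  shows "(\<lambda>t. g t * cis t / (cis t - z)) integrable_on {-pi..pi}"
  using assms by (intro integrable_continuous_real continuous_intros)
    (auto intro: continuous_on_subset)

text \<open>Convexity is what differentiation under the integral asks for. The exterior of the disc
  is not convex and is covered by balls afterwards.\<close>

lemma cauchy_transform_holomorphic_convex:
  assumes g: "continuous_on UNIV g" and U: "convex U" "U \<inter> sphere 0 1 = {}"
  shows "cauchy_transform g holomorphic_on U"
proof -
  have ne: "cis t - z \<noteq> 0" if "z \<in> U" for z t using that U by auto
  have "(\<lambda>z. integral (cbox (-pi) pi) (\<lambda>t. g t * cis t / (cis t - z))) holomorphic_on U"
  proof (rule leibniz_rule_holomorphic[where fx = "\<lambda>z t. g t * cis t / (cis t - z) ^ 2"])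
    show "((\<lambda>z. g t * cis t / (cis t - z)) has_field_derivative g t * cis t / (cis t - z) ^ 2) (at z within U)"
      if "z \<in> U" for z t
      using ne[OF that] by (auto intro!: derivative_eq_intros simp: power2_eq_square)
    show "(\<lambda>t. g t * cis t / (cis t - z)) integrable_on cbox (-pi) pi" if "z \<in> U" for z
      using that U cauchy_transform_integrable[OF g, of z] by (metis cbox_interval disjoint_iff)
    have "continuous_on (U \<times> cbox (-pi) pi) (\<lambda>p. g (snd p) * cis (snd p) / (cis (snd p) - fst p) ^ 2)"
      using ne by (intro continuous_intros continuous_on_compose2[OF g]) auto
    then show "continuous_on (U \<times> cbox (-pi) pi) (\<lambda>(z, t). g t * cis t / (cis t - z) ^ 2)"
      by (simp add: case_prod_unfold)
  qed (use U in auto)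
  then show ?thesis by (simp add: cauchy_transform_def[abs_def])
qed

lemma cauchy_transform_holomorphic_inside:
  assumes "continuous_on UNIV g"
  shows "cauchy_transform g holomorphic_on ball 0 1"
  using assms by (intro cauchy_transform_holomorphic_convex) auto

lemma cauchy_transform_holomorphic_outside:
  assumes "continuous_on UNIV g"
  shows "cauchy_transform g holomorphic_on {z. norm z > 1}"
proof -
  have "open {z::complex. norm z > 1}" by (intro open_Collect_less continuous_intros)
  then have ex: "\<exists>e>0. ball z e \<subseteq> {z. norm z > 1}" if "norm z > 1" for z :: complex
    using that by (auto simp: open_contains_ball)
  have "cauchy_transform g field_differentiable at z" if z: "norm z > 1" for z
  proof -
    obtain e where e: "e > 0" "ball z e \<subseteq> {z. norm z > 1}"
      using ex z by blast
    have "cauchy_transform g holomorphic_on ball z e"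
      using assms e by (intro cauchy_transform_holomorphic_convex) auto
    then show ?thesis using e by (auto intro: holomorphic_on_imp_differentiable_at)
  qed
  then show ?thesis
    by (auto simp: holomorphic_on_def intro: field_differentiable_at_within)
qed

lemma periodic_continuous_bounded:
  fixes g :: "real \<Rightarrow> 'a::real_normed_vector"
  assumes "continuous_on UNIV g" "\<And>t. g (t + 2 * pi) = g t"
  obtains B where "0 < B" "\<And>t. norm (g t) \<le> B"
proof -
  have "bounded (g ` {0..2*pi})"
    using assms by (intro compact_imp_bounded compact_continuous_image) (auto intro: continuous_on_subset)
  then obtain B where B: "0 < B" "\<And>t. t \<in> {0..2*pi} \<Longrightarrow> norm (g t) \<le> B"
    unfolding bounded_pos by auto
  interpret g: periodic_fun_simple g "2 * pi" by standard (rule assms)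
  have "norm (g t) \<le> B" for t
  proof -
    define m where "m = \<lfloor>t / (2 * pi)\<rfloor>"
    have "of_int m \<le> t / (2 * pi)" "t / (2 * pi) < of_int m + 1" unfolding m_def by linarith+
    then have "t - of_int m * (2 * pi) \<in> {0..2*pi}"
      by (simp add: field_simps)
    then show ?thesis using B(2) g.minus_of_int[of t m] by metis
  qed
  with B that show ?thesis by blast
qed

text \<open>The kernel is expanded as a finite geometric sum about 2 with explicit remainder
  \<open>R N\<close>, so no infinite sum is exchanged with an integral. The ratio is at most
  \<open>norm (z - 2) < 1\<close> because the circle has distance at least 1 from 2.\<close>

lemma cauchy_transform_taylor2:
  assumes g: "continuous_on UNIV g" and z: "norm (z - 2) < 1"
  shows "(\<lambda>n. taylor2 n g * (z - 2) ^ n) sums cauchy_transform g z"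
proof -
  define R where "R N = integral {-pi..pi} (\<lambda>t. g t * cis t / (cis t - z) * ((z - 2) / (cis t - 2)) ^ N)" for N
  have far: "1 - norm (z - 2) \<le> norm (cis t - z)" for t
    using norm_cis_minus_2_ge_1[of t] norm_triangle_ineq[of "cis t - z" "z - 2"] by simp
  have ne: "cis t - z \<noteq> 0" for t using far[of t] z by auto
  have int: "continuous_on {-pi..pi} (\<lambda>t. g t * cis t / (cis t - z) * ((z - 2) / (cis t - 2)) ^ N)" for N
    using ne by (intro continuous_intros continuous_on_subset[OF g]) auto
  have alg: "A / d * (x / e) ^ N * (1 - d / e) = A / d * (x / e) ^ N - A / e ^ Suc N * x ^ N"
    if "d \<noteq> 0" "e \<noteq> 0" for A d e x :: complex and N
    using that by (simp add: field_simps power_divide)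
  have step: "R N = taylor2 N g * (z - 2) ^ N + R (Suc N)" for N
  proof -
    have eq: "g t * cis t / (cis t - z) * ((z - 2) / (cis t - 2)) ^ N =
       (g t * cis t / (cis t - 2) ^ Suc N) * (z - 2) ^ N
          + g t * cis t / (cis t - z) * ((z - 2) / (cis t - 2)) ^ Suc N" for t
    proof -
      have "(z - 2) / (cis t - 2) = 1 - (cis t - z) / (cis t - 2)" by (simp add: field_simps)
      then have "g t * cis t / (cis t - z) * ((z - 2) / (cis t - 2)) ^ Suc N =
         g t * cis t / (cis t - z) * ((z - 2) / (cis t - 2)) ^ N * (1 - (cis t - z) / (cis t - 2))"
        by simp
      also have "\<dots> = g t * cis t / (cis t - z) * ((z - 2) / (cis t - 2)) ^ N -
          (g t * cis t / (cis t - 2) ^ Suc N) * (z - 2) ^ N"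
        using alg[OF ne[of t], of "cis t - 2"] by simp
      finally show ?thesis by simp
    qed
    have "(\<lambda>t. (g t * cis t / (cis t - 2) ^ Suc N) * (z - 2) ^ N) integrable_on {-pi..pi}"
      using continuous_on_subset[OF g]
      by (intro integrable_on_mult_left taylor2_integrable) auto
    then have "R N = integral {-pi..pi} (\<lambda>t. (g t * cis t / (cis t - 2) ^ Suc N) * (z - 2) ^ N) + R (Suc N)"
      unfolding R_def by (subst eq, intro integral_add) (assumption | rule integrable_continuous_real int)+
    then show ?thesis by (simp only: taylor2_def integral_mult_left)
  qed
  have "cauchy_transform g z = R 0" by (simp add: R_def cauchy_transform_def)
  then have part: "(\<Sum>n<N. taylor2 n g * (z - 2) ^ n) = cauchy_transform g z - R N" for N
  proof (induction N)
    case (Suc N)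
    then show ?case using step[of N] by (simp add: algebra_simps)
  qed simp
  have "bounded (g ` {-pi..pi})"
    using g by (intro compact_imp_bounded compact_continuous_image) (auto intro: continuous_on_subset)
  then obtain B where B: "0 < B" "\<And>t. t \<in> {-pi..pi} \<Longrightarrow> norm (g t) \<le> B"
    unfolding bounded_pos by auto
  have "norm (R N) \<le> (B / (1 - norm (z - 2)) * norm (z - 2) ^ N) * (pi - -pi)" for N
    unfolding R_def
  proof (rule integral_bound)
    fix t assume t: "t \<in> {-pi..pi}"
    have "norm ((z - 2) / (cis t - 2)) \<le> norm (z - 2)"
      using norm_cis_minus_2_ge_1[of t]
      by (simp add: norm_divide divide_le_eq mult_le_cancel_left1)
    then have "norm ((z - 2) / (cis t - 2)) ^ N \<le> norm (z - 2) ^ N"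
      by (intro power_mono) auto
    moreover have "norm (g t * cis t / (cis t - z)) \<le> B / (1 - norm (z - 2))"
      using far[of t] B(2)[OF t] z B(1) unfolding norm_divide norm_mult by (intro frac_le) auto
    ultimately show "norm (g t * cis t / (cis t - z) * ((z - 2) / (cis t - 2)) ^ N)
        \<le> B / (1 - norm (z - 2)) * norm (z - 2) ^ N"
      using z B(1) unfolding norm_mult[of _ "_ ^ N"] norm_power by (intro mult_mono) auto
  qed (use int in auto)
  moreover have "(\<lambda>N. (B / (1 - norm (z - 2)) * norm (z - 2) ^ N) * (pi - -pi)) \<longlonglongrightarrow> 0"
    using z by (intro tendsto_mult_left_zero tendsto_mult_right_zero LIMSEQ_power_zero) auto
  ultimately have "R \<longlonglongrightarrow> 0"
    by (intro Lim_null_comparison[of R]) auto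
  then have "(\<lambda>N. cauchy_transform g z - R N) \<longlonglongrightarrow> cauchy_transform g z - 0"
    by (intro tendsto_intros)
  then show ?thesis unfolding sums_def part by simp
qed

text \<open>The tangents from 2 to the unit circle have length sqrt 3, and
  \<open>1 + s \<le> 3/2\<close> is shorter: no exterior point of the ball lies in the shadow of the
  disc seen from 2. This gives the connectedness needed by the identity theorem and is the reason
  for \<open>s \<le> 1/2\<close> throughout.\<close>

lemma starlike_outside_disc:
  assumes s: "0 < s" "s \<le> 1/2"
  shows "starlike (ball 2 (1 + s) \<inter> {z::complex. norm z > 1})"
  unfolding starlike_def
proof (intro bexI[of _ 2] ballI subsetI)
  show "2 \<in> ball 2 (1 + s) \<inter> {z::complex. norm z > 1}" using s by auto
  fix z w :: complex assume z: "z \<in> ball 2 (1 + s) \<inter> {z. norm z > 1}" and w: "w \<in> closed_segment 2 z"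
  then obtain u where u: "0 \<le> u" "u \<le> 1" "w = (1 - u) *\<^sub>R 2 + u *\<^sub>R z" by (auto simp: closed_segment_def)
  define v where "v = z - 2"
  have wv: "w = 2 + of_real u * v" and zv: "z = 2 + v"
    using u by (auto simp: v_def scaleR_conv_of_real algebra_simps)
  have "norm v < 1 + s" using z by (simp add: v_def dist_norm norm_minus_commute)
  then have "norm v ^ 2 \<le> (3/2) ^ 2" using s by (intro power_mono) auto
  then have v2: "norm v ^ 2 < 3" by (simp add: power2_eq_square)
  have q: "norm (2 + of_real c * v) ^ 2 = 4 + 4 * c * Re v + c ^ 2 * norm v ^ 2" for c
    unfolding cmod_power2 by (simp add: power2_eq_square algebra_simps)
  have "1 < norm z ^ 2" using z by (auto intro!: one_less_power)
  then have z1: "4 + 4 * Re v + norm v ^ 2 > 1" using q[of 1] zv by simp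
  have "norm w > 1"
  proof (cases "u = 0")
    case True then show ?thesis using wv by simp
  next
    case False
    have "u * (3 + 4 * Re v + norm v ^ 2) > 0"
      using z1 False u by (intro mult_pos_pos) auto
    moreover have "(1 - u) * (3 - u * norm v ^ 2) \<ge> 0"
      using u v2 mult_mono[of u 1 "norm v ^ 2" 3] by (intro mult_nonneg_nonneg) auto
    \<comment> \<open>\<open>norm w ^ 2 - 1\<close> is exactly the sum of the two quantities just
      estimated.\<close>
    ultimately have "1 < 4 + 4 * u * Re v + u ^ 2 * norm v ^ 2"
      by (simp add: power2_eq_square algebra_simps)
    then have "1 < norm w ^ 2" using q[of u] wv by simp
    then show ?thesis
      using power_le_one[of "norm w" 2] by force
  qed
  moreover have "w \<in> ball 2 (1 + s)"
  proof -
    have "closed_segment 2 z \<subseteq> ball 2 (1 + s)"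
      using z s by (intro closed_segment_subset) auto
    then show ?thesis using w by auto
  qed
  ultimately show "w \<in> ball 2 (1 + s) \<inter> {z. norm z > 1}" by simp
qed

text \<open>\<open>H\<close> is the Taylor series about 2. It equals the transform on
  \<open>ball 2 1\<close>, and the identity theorem spreads this over the exterior part of
  \<open>ball 2 (1 + s)\<close>, a ball that contains \<open>ball 1 s\<close>.\<close>

lemma geometric_bound_imp_continuation:
  assumes g: "continuous_on UNIV g" and s: "0 < s" "s \<le> 1/2" and M: "geometric_bound s M g"
  obtains H where "H holomorphic_on ball 1 s"
    "\<And>z. z \<in> ball 1 s \<Longrightarrow> norm z > 1 \<Longrightarrow> H z = cauchy_transform g z"
proof -
  define H where "H z = (\<Sum>n. taylor2 n g * (z - 2) ^ n)" for z
  have sums: "(\<lambda>n. taylor2 n g * (z - 2) ^ n) sums H z" if z: "z \<in> ball 2 (1 + s)" for z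
  proof -
    define x where "x = norm (z - 2) / (1 + s)"
    have x: "0 \<le> x" "x < 1" using z s by (auto simp: x_def dist_norm norm_minus_commute)
    have le: "norm (taylor2 n g * (z - 2) ^ n) \<le> M * x ^ n" for n
    proof -
      have "norm (taylor2 n g * (z - 2) ^ n) = (norm (taylor2 n g) * (1 + s) ^ n) * x ^ n"
        using s by (simp add: x_def norm_mult norm_power power_divide)
      then show ?thesis using M x unfolding geometric_bound_def by (auto intro: mult_right_mono)
    qed
    have sm: "summable (\<lambda>n. M * x ^ n)" using x by (intro summable_mult summable_geometric) auto
    have "summable (\<lambda>n. taylor2 n g * (z - 2) ^ n)"
      by (rule summable_comparison_test'[OF sm, of 0]) (rule le)
    then show ?thesis unfolding H_def by (rule summable_sums)
  qed
  have Hhol: "H holomorphic_on ball 2 (1 + s)"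
    by (rule power_series_holomorphic) (rule sums)
  have H1: "H z = cauchy_transform g z" if "z \<in> ball 2 1" for z
    using that cauchy_transform_taylor2[OF g, of z]
    by (simp add: H_def sums_iff dist_norm norm_minus_commute)
  let ?S = "ball 2 (1 + s) \<inter> {z :: complex. norm z > 1}"
  have "ball 2 1 \<subseteq> {z::complex. norm z > 1}"
  proof
    fix z :: complex assume "z \<in> ball 2 1"
    then show "z \<in> {z. norm z > 1}"
      using norm_triangle_ineq2[of 2 "2 - z"] by (auto simp: dist_norm)
  qed
  have opn: "open {z::complex. norm z > 1}" by (intro open_Collect_less continuous_intros)
  have "H z = cauchy_transform g z" if "z \<in> ?S" for z
  proof (rule analytic_continuation_open[where s = "ball 2 1" and s' = ?S and f = H and g = "cauchy_transform g"])
    show "connected ?S" using starlike_outside_disc[OF s] by (rule starlike_imp_connected)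
    show "H holomorphic_on ?S" using Hhol by (rule holomorphic_on_subset) auto
    show "cauchy_transform g holomorphic_on ?S"
      using cauchy_transform_holomorphic_outside[OF g] by (rule holomorphic_on_subset) auto
  qed (use opn that s H1 \<open>ball 2 1 \<subseteq> _\<close> in auto)
  moreover have "ball 1 s \<subseteq> ball (2::complex) (1 + s)"
    by (simp add: ball_subset_ball_iff dist_norm)
  ultimately show ?thesis
    using that[of H] holomorphic_on_subset[OF Hhol, of "ball 1 s"] by blast
qed

section \<open>The Poisson kernel and the jump of the Cauchy transform\<close>

lemma continuous_on_circle_lift:
  fixes g :: "real \<Rightarrow> 'a::topological_space"
  assumes g: "continuous_on UNIV g" and per: "\<And>t. g (t + 2 * pi) = g t"
  obtains u where "continuous_on (sphere 0 1) u" "\<And>t. u (cis t) = g t"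
proof -
  interpret g: periodic_fun_simple g "2 * pi" by standard (rule per)
  have cisg: "g a = g b" if "cis a = cis b" for a b
  proof -
    have "sin a = sin b \<and> cos a = cos b" using that by (simp add: complex_eq_iff)
    then obtain m :: int where "a = b + 2 * pi * m" unfolding sin_cos_eq_iff by auto
    then show ?thesis using g.plus_of_int[of b m] by (simp add: mult.commute)
  qed
  define u where "u w = g (Arg w)" for w
  have ucis: "u (cis t) = g t" for t
    unfolding u_def by (intro cisg) (simp add: cis_Arg)
  have cont: "isCont (\<lambda>w. g (f w)) w" if "isCont f w" for f and w :: complex
    using g that by (auto intro: isCont_o2 simp: continuous_on_eq_continuous_at)
  have "continuous (at w within sphere 0 1) u" if w: "w \<in> sphere 0 1" for w
  proof (cases "w \<in> \<real>\<^sub>\<le>\<^sub>0")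
    case False
    then have "isCont u w" unfolding u_def[abs_def] by (intro cont continuous_at_Arg)
    then show ?thesis by (rule continuous_at_imp_continuous_at_within)
  next
    case True
    moreover have "w \<noteq> 0" using w by auto
    ultimately have "- w \<notin> \<real>\<^sub>\<le>\<^sub>0" by (auto simp: complex_nonpos_Reals_iff complex_eq_iff)
    \<comment> \<open>Near the cut of \<open>Arg\<close>, \<open>Arg (- w) + pi\<close> is a
      continuous angle of \<open>w\<close>. It may differ from \<open>Arg w\<close> by a full turn,
      which \<open>g\<close> does not notice.\<close>
    then have "isCont (\<lambda>w. Arg (- w)) w"
      by (intro isCont_o2[where f = uminus and g = Arg] continuous_at_Arg) auto
    then have "isCont (\<lambda>w. g (Arg (- w) + pi)) w" by (intro cont continuous_intros)
    then have "continuous (at w within sphere 0 1) (\<lambda>w. g (Arg (- w) + pi))"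
      by (rule continuous_at_imp_continuous_at_within)
    then show ?thesis
    proof (rule continuous_transform_within[OF _ zero_less_one w])
      fix v :: complex assume v: "v \<in> sphere 0 1"
      then have "v \<noteq> 0" by auto
      then show "g (Arg (- v) + pi) = u v"
        unfolding u_def using v
        by (intro cisg) (auto simp: cis_mult[symmetric] cis_Arg sgn_eq)
    qed
  qed
  then have "continuous_on (sphere 0 1) u" by (simp add: continuous_on_eq_continuous_within)
  then show ?thesis using that ucis by blast
qed

lemma cis_minus_pi: "cis (- pi) = -1"
  by (simp add: complex_eq_iff)

text \<open>\<open>t - \<i> * Ln (1 - z * cis (-t))\<close> is a primitive of the kernel; the
  logarithm is principal, since its argument has positive real part. The logarithm agrees at both
  ends, and the linear term gives \<open>2 * pi\<close>. With the exterior value 0 this fixes the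
  total mass of the Poisson kernel.\<close>

lemma cauchy_transform_1_inside:
  assumes z: "norm z < 1"
  shows "cauchy_transform (\<lambda>_. 1) z = 2 * pi"
proof -
  have lt: "norm (z * cis (-t)) < 1" for t using z by (simp add: norm_mult)
  have re: "1 - z * cis (-t) \<notin> \<real>\<^sub>\<le>\<^sub>0" for t
    using lt[of t] abs_Re_le_cmod[of "z * cis (-t)"] by (auto simp: complex_nonpos_Reals_iff)
  have ne: "cis t \<noteq> z" for t using z by auto
  have deriv: "((\<lambda>t. of_real t - \<i> * Ln (1 - z * cis (-t))) has_vector_derivative cis t / (cis t - z)) (at t within S)" for t S
    using re[of t] ne[of t] unfolding cis_conv_exp of_real_minus
    by (intro has_vector_derivative_real_field)
       (auto intro!: derivative_eq_intros simp: divide_simps exp_minus, simp add: algebra_simps)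
  have "((\<lambda>t. 1 * cis t / (cis t - z)) has_integral 2 * pi) {-pi..pi}"
    using fundamental_theorem_of_calculus[of "-pi" pi "\<lambda>t. of_real t - \<i> * Ln (1 - z * cis (-t))", OF _ deriv]
    by (simp add: cis_minus_pi)
  then show ?thesis unfolding cauchy_transform_def by (rule integral_unique)
qed

lemma cauchy_transform_1_outside:
  assumes z: "norm z > 1"
  shows "cauchy_transform (\<lambda>_. 1) z = 0"
proof -
  have lt: "norm (cis t / z) < 1" for t using z by (simp add: norm_divide divide_simps)
  have re: "1 - cis t / z \<notin> \<real>\<^sub>\<le>\<^sub>0" for t
    using lt[of t] abs_Re_le_cmod[of "cis t / z"] by (simp add: complex_nonpos_Reals_iff)
  have ne: "cis t \<noteq> z" for t using z by auto
  have z0: "z \<noteq> 0" using z by auto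
  have deriv: "((\<lambda>t. - \<i> * Ln (1 - cis t / z)) has_vector_derivative cis t / (cis t - z)) (at t within S)" for t S
    using re[of t] ne[of t] z0 unfolding cis_conv_exp
    by (intro has_vector_derivative_real_field) (auto intro!: derivative_eq_intros simp: divide_simps)
  have "((\<lambda>t. 1 * cis t / (cis t - z)) has_integral 0) {-pi..pi}"
    using fundamental_theorem_of_calculus[of "-pi" pi "\<lambda>t. - \<i> * Ln (1 - cis t / z)", OF _ deriv]
    by (simp add: cis_minus_pi)
  then show ?thesis unfolding cauchy_transform_def by (rule integral_unique)
qed

text \<open>\<open>1 / cnj z\<close> is the mirror image of \<open>z\<close> in the circle. The
  difference of the two Cauchy kernels is real and positive, which makes it an approximate identity;
  neither kernel has this property alone.\<close>

lemma poisson_kernel_eq: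
  assumes z: "z \<noteq> 0" "norm z < 1"
  shows "cis t / (cis t - z) - cis t / (cis t - 1 / cnj z)
     = of_real ((1 - norm z ^ 2) / norm (cis t - z) ^ 2)"
proof -
  define w where "w = cis t"
  have ww: "w * cnj w = 1" "w \<noteq> 0" by (auto simp: w_def cis_cnj cis_mult)
  have ne: "w - z \<noteq> 0" using z by (auto simp: w_def)
  then have ne': "cnj w - cnj z \<noteq> 0" by (metis complex_cnj_cancel_iff right_minus_eq)
  have "w - 1 / cnj z = - w * (cnj w - cnj z) / cnj z"
    using z ww(1) by (simp add: field_simps)
  then have "w / (w - 1 / cnj z) = - cnj z / (cnj w - cnj z)"
    using z(1) ww(2) ne' by simp
  then have "w / (w - z) - w / (w - 1 / cnj z) = w / (w - z) + cnj z / (cnj w - cnj z)"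
    by simp
  also have "\<dots> = (w * (cnj w - cnj z) + cnj z * (w - z)) / ((w - z) * (cnj w - cnj z))"
    using ne ne' by (simp add: add_frac_eq mult.commute)
  also have "w * (cnj w - cnj z) + cnj z * (w - z) = 1 - z * cnj z"
    using ww(1) by (simp add: algebra_simps)
  also have "\<dots> = of_real (1 - norm z ^ 2)" using complex_norm_square[of z] by simp
  also have "(w - z) * (cnj w - cnj z) = of_real (norm (w - z) ^ 2)"
    using complex_norm_square[of "w - z"] by simp
  finally show ?thesis by (simp add: w_def)
qed

lemma tendsto_inverse_cnj:
  assumes "norm w = 1"
  shows "((\<lambda>z. 1 / cnj z) \<longlongrightarrow> w) (at w within S)"
proof -
  have "w \<noteq> 0" using assms by auto
  moreover have "1 / cnj w = w" using assms \<open>w \<noteq> 0\<close> complex_norm_square[of w] by (simp add: field_simps)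
  ultimately show ?thesis using tendsto_divide[OF tendsto_const tendsto_cnj[OF tendsto_ident_at[of w S]], of 1]
    by auto
qed

text \<open>The usual approximate identity argument. The limit is along arbitrary approach within
  the disc, not only radial, since it has to yield continuity of an extension at boundary
  points.\<close>

lemma poisson_tendsto:
  fixes g :: "real \<Rightarrow> complex"
  assumes g: "continuous_on UNIV g" and per: "\<And>t. g (t + 2 * pi) = g t"
  shows "((\<lambda>z. cauchy_transform g z - cauchy_transform g (1 / cnj z)) \<longlongrightarrow> 2 * pi * g \<theta>)
          (at (cis \<theta>) within ball 0 1)"
proof (rule tendstoI)
  fix e :: real assume e: "e > 0"
  obtain u where u: "continuous_on (sphere 0 1) u" "\<And>t. u (cis t) = g t"
    using continuous_on_circle_lift[OF g per] by blast
  obtain B where B: "0 < B" "\<And>t. norm (g t) \<le> B"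
    using periodic_continuous_bounded[OF g per] by blast
  obtain \<eta> where \<eta>: "\<eta> > 0" "\<And>w. w \<in> sphere 0 1 \<Longrightarrow> dist w (cis \<theta>) < \<eta> \<Longrightarrow> dist (u w) (u (cis \<theta>)) < e / (4 * pi)"
    using u(1) e unfolding continuous_on_iff by (metis dist_commute norm_cis mem_sphere_0 divide_pos_pos mult_pos_pos pi_gt_zero zero_less_numeral)
  \<comment> \<open>Bounds the integrand away from \<open>cis \<theta>\<close>: oscillation at most
    \<open>2 * B\<close>, and distance at least \<open>\<eta> / 2\<close> from \<open>z\<close> in
    the kernel. It vanishes as \<open>norm z\<close> tends to 1. The near part contributes
    \<open>e / (4 * pi)\<close> times the mass \<open>2 * pi\<close>, that is
    \<open>e / 2\<close>.\<close>
  let ?D = "\<lambda>z. 2 * B * (1 - norm z ^ 2) / (\<eta> / 2) ^ 2"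
  let ?P = "\<lambda>z t. (1 - norm z ^ 2) / norm (cis t - z) ^ 2"
  have est: "norm (cauchy_transform g z - cauchy_transform g (1 / cnj z) - 2 * pi * g \<theta>) \<le> e / 2 + 2 * pi * ?D z"
    if z: "z \<noteq> 0" "norm z < 1" "dist z (cis \<theta>) < \<eta> / 2" for z
  proof -
    have nz: "norm (1 / cnj z) > 1" using z by (simp add: norm_divide)
    have sph: "z \<notin> sphere 0 1" "1 / cnj z \<notin> sphere 0 1" using nz z(2) by auto
    have ne: "cis t - z \<noteq> 0" for t using z by auto
    have "cauchy_transform f z - cauchy_transform f (1 / cnj z) = integral {-pi..pi} (\<lambda>t. f t * of_real (?P z t))"
      if "continuous_on UNIV f" for f
    proof -
      have "f t * cis t / (cis t - z) - f t * cis t / (cis t - 1 / cnj z) = f t * of_real (?P z t)" for t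
        unfolding poisson_kernel_eq[OF z(1,2), symmetric] by (simp add: right_diff_distrib)
      then show ?thesis
        unfolding cauchy_transform_def
        using cauchy_transform_integrable[OF that sph(1)] cauchy_transform_integrable[OF that sph(2)]
        by (subst integral_diff[symmetric]) simp_all
    qed
    note C = this[OF g] this[OF continuous_on_const, of 1]
    have P1: "integral {-pi..pi} (\<lambda>t. of_real (?P z t)) = (2 * pi :: complex)"
      using C(2) cauchy_transform_1_inside[OF z(2)] cauchy_transform_1_outside[OF nz] by simp
    have contP: "continuous_on {-pi..pi} (\<lambda>t. ?P z t)"
      using ne by (intro continuous_intros) (auto simp del: right_minus_eq)
    then have contP': "continuous_on {-pi..pi} (\<lambda>t. of_real (?P z t) :: complex)"
      by (rule continuous_on_of_real)
    have "integral {-pi..pi} (\<lambda>t. of_real (?P z t) :: complex) = of_real (integral {-pi..pi} (?P z))"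
      by (intro integral_unique has_integral_of_real integrable_integral integrable_continuous_real contP)
    then have "of_real (integral {-pi..pi} (?P z)) = (of_real (2 * pi) :: complex)"
      using P1 by simp
    then have P1': "integral {-pi..pi} (?P z) = 2 * pi" unfolding of_real_eq_iff .
    have intg: "(\<lambda>t. g t * of_real (?P z t)) integrable_on {-pi..pi}"
      by (intro integrable_continuous_real continuous_on_mult contP' continuous_on_subset[OF g]) auto
    have intc: "(\<lambda>t. g \<theta> * of_real (?P z t)) integrable_on {-pi..pi}"
      by (intro integrable_on_mult_right integrable_continuous_real contP')
    have "cauchy_transform g z - cauchy_transform g (1 / cnj z) - 2 * pi * g \<theta>
       = integral {-pi..pi} (\<lambda>t. g t * of_real (?P z t)) - integral {-pi..pi} (\<lambda>t. g \<theta> * of_real (?P z t))"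
      using C(1) P1 by (simp only: integral_mult_right mult.commute)
    also have "\<dots> = integral {-pi..pi} (\<lambda>t. (g t - g \<theta>) * of_real (?P z t))"
      by (subst integral_diff[OF intg intc, symmetric]) (simp only: left_diff_distrib)
    finally have eq: "cauchy_transform g z - cauchy_transform g (1 / cnj z) - 2 * pi * g \<theta> =
       integral {-pi..pi} (\<lambda>t. (g t - g \<theta>) * of_real (?P z t))" .
    have "norm (integral {-pi..pi} (\<lambda>t. (g t - g \<theta>) * of_real (?P z t)))
       \<le> integral {-pi..pi} (\<lambda>t. e / (4 * pi) * ?P z t + ?D z)"
    proof (rule integral_norm_bound_integral)
      show "(\<lambda>t. (g t - g \<theta>) * of_real (?P z t)) integrable_on {-pi..pi}"
        by (intro integrable_continuous_real continuous_on_mult contP' continuous_intros continuous_on_subset[OF g]) auto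
      show "(\<lambda>t. e / (4 * pi) * ?P z t + ?D z) integrable_on {-pi..pi}"
        by (intro integrable_continuous_real continuous_intros contP)
      fix t
      have z2: "0 \<le> 1 - norm z ^ 2" using z by (simp add: power_le_one)
      then have P0: "0 \<le> ?P z t" by simp
      have D0: "0 \<le> ?D z" using z2 B by auto
      have nm: "norm ((g t - g \<theta>) * of_real (?P z t)) = norm (g t - g \<theta>) * ?P z t"
        using P0 by (simp only: norm_mult norm_of_real abs_of_nonneg)
      show "norm ((g t - g \<theta>) * of_real (?P z t)) \<le> e / (4 * pi) * ?P z t + ?D z"
      proof (cases "dist (cis t) (cis \<theta>) < \<eta>")
        case True
        then have "norm (g t - g \<theta>) \<le> e / (4 * pi)" using \<eta>(2)[of "cis t"] u(2) by (simp add: dist_norm)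
        then have "norm (g t - g \<theta>) * ?P z t \<le> e / (4 * pi) * ?P z t" using P0 by (intro mult_right_mono)
        then show ?thesis unfolding nm using D0 by linarith
      next
        case False
        then have "\<eta> / 2 \<le> norm (cis t - z)"
          using z(3) dist_triangle[of "cis t" "cis \<theta>" z] by (simp add: dist_norm)
        then have "(\<eta> / 2) ^ 2 \<le> norm (cis t - z) ^ 2" using \<eta> by (intro power_mono) auto
        then have "?P z t \<le> (1 - norm z ^ 2) / (\<eta> / 2) ^ 2"
          using \<eta> z2 by (intro divide_left_mono) (auto intro!: mult_pos_pos simp: ne)
        moreover have "norm (g t - g \<theta>) \<le> 2 * B"
          using B(2)[of t] B(2)[of \<theta>] norm_triangle_ineq4[of "g t" "g \<theta>"] by linarith
        ultimately have "norm (g t - g \<theta>) * ?P z t \<le> 2 * B * ((1 - norm z ^ 2) / (\<eta> / 2) ^ 2)"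
          using P0 B by (intro mult_mono) auto
        then have "norm (g t - g \<theta>) * ?P z t \<le> ?D z" by (simp only: times_divide_eq_right)
        moreover have "0 \<le> e / (4 * pi) * ?P z t" using P0 e by (intro mult_nonneg_nonneg) auto
        ultimately show ?thesis unfolding nm by linarith
      qed
    qed
    also have "\<dots> = integral {-pi..pi} (\<lambda>t. e / (4 * pi) * ?P z t) + integral {-pi..pi} (\<lambda>t. ?D z)"
      by (intro integral_add integrable_continuous_real continuous_intros contP)
    also have "\<dots> = e / 2 + 2 * pi * ?D z" using P1' by (simp only: integral_mult_right) simp
    finally show ?thesis unfolding eq .
  qed
  have "((\<lambda>z. 2 * pi * ?D z) \<longlongrightarrow> 2 * pi * ?D (cis \<theta>)) (at (cis \<theta>) within ball 0 1)"
    using \<eta> by (intro tendsto_intros) auto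
  then have "\<forall>\<^sub>F z in at (cis \<theta>) within ball 0 1. 2 * pi * ?D z < e / 2"
    using e by (intro order_tendstoD(2)[of _ "2 * pi * ?D (cis \<theta>)"]) auto
  moreover have "\<forall>\<^sub>F z in at (cis \<theta>) within ball 0 1. z \<in> ball 0 1"
    by (simp add: eventually_at_filter)
  moreover have "\<forall>\<^sub>F z in at (cis \<theta>) within ball 0 1. dist z (cis \<theta>) < \<eta> / 2"
    using \<eta>(1) unfolding eventually_at by (intro exI[of _ "\<eta> / 2"]) auto
  \<comment> \<open>Keeps \<open>z\<close> away from 0, where \<open>1 / cnj z\<close> has only its
    default value and is no mirror point.\<close>
  moreover have "\<forall>\<^sub>F z in at (cis \<theta>) within ball 0 1. dist z (cis \<theta>) < 1"
    unfolding eventually_at by (intro exI[of _ 1]) auto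
  ultimately show "\<forall>\<^sub>F z in at (cis \<theta>) within ball 0 1.
      dist (cauchy_transform g z - cauchy_transform g (1 / cnj z)) (2 * pi * g \<theta>) < e"
  proof eventually_elim
    case (elim z)
    then have "z \<noteq> 0" by auto
    then show ?case using est[of z] elim by (simp add: dist_norm)
  qed
qed

section \<open>Local extensions and coefficient bounds\<close>

text \<open>Stated without membership in \<open>Ck\<close>, so that it applies to rotated and
  reflected functions at once.\<close>

definition extends_inside :: "complex \<Rightarrow> (real \<Rightarrow> complex) \<Rightarrow> bool" where
  "extends_inside z0 g \<longleftrightarrow> (\<exists>r>0. \<exists>L. continuous_on (sphere 0 1 \<union> Pdisk z0 r) L
     \<and> L holomorphic_on Pdisk z0 r \<and> agrees_on_arc L g z0 r)"

definition extends_outside :: "complex \<Rightarrow> (real \<Rightarrow> complex) \<Rightarrow> bool" where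
  "extends_outside z0 g \<longleftrightarrow> (\<exists>r>0. \<exists>L. continuous_on (sphere 0 1 \<union> Omega z0 r) L
     \<and> L holomorphic_on Omega z0 r \<and> agrees_on_arc L g z0 r)"

definition extends_across :: "complex \<Rightarrow> (real \<Rightarrow> complex) \<Rightarrow> bool" where
  "extends_across z0 g \<longleftrightarrow> (\<exists>r>0. \<exists>F. F holomorphic_on ball z0 r \<and> agrees_on_arc F g z0 r)"

text \<open>For \<open>z\<close> close to the arc, the exterior value at the mirror point is
  \<open>H (1 / cnj z)\<close>. As \<open>H\<close> is continuous at \<open>cis \<theta>\<close>, it
  may be replaced by \<open>H z\<close> in the limit, which leaves a function holomorphic inside
  with boundary values \<open>2 * pi * g \<theta>\<close>.\<close>

lemma continuation_tendsto:
  fixes g :: "real \<Rightarrow> complex"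
  assumes g: "continuous_on UNIV g" and per: "\<And>t. g (t + 2 * pi) = g t"
    and H: "H holomorphic_on ball 1 s" "\<And>z. z \<in> ball 1 s \<Longrightarrow> norm z > 1 \<Longrightarrow> H z = cauchy_transform g z"
    and \<theta>: "cis \<theta> \<in> ball 1 s"
  shows "((\<lambda>z. cauchy_transform g z - H z) \<longlongrightarrow> 2 * pi * g \<theta>) (at (cis \<theta>) within ball 0 1)"
proof -
  let ?F = "at (cis \<theta>) within ball 0 1"
  have inv: "((\<lambda>z. 1 / cnj z) \<longlongrightarrow> cis \<theta>) ?F" by (rule tendsto_inverse_cnj) simp
  have "isCont H (cis \<theta>)"
    using H(1) \<theta> by (metis continuous_on_eq_continuous_at holomorphic_on_imp_continuous_on open_ball)
  then have "((\<lambda>z. H (1 / cnj z)) \<longlongrightarrow> H (cis \<theta>)) ?F" "(H \<longlongrightarrow> H (cis \<theta>)) ?F"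
    using isCont_tendsto_compose[OF _ inv] isCont_tendsto_compose[OF _ tendsto_ident_at] by auto
  then have "((\<lambda>z. (cauchy_transform g z - cauchy_transform g (1 / cnj z)) + (H (1 / cnj z) - H z))
       \<longlongrightarrow> 2 * pi * g \<theta> + (H (cis \<theta>) - H (cis \<theta>))) ?F"
    by (intro tendsto_add tendsto_diff poisson_tendsto[OF g per])
  moreover have "\<forall>\<^sub>F z in ?F. (cauchy_transform g z - cauchy_transform g (1 / cnj z)) + (H (1 / cnj z) - H z)
      = cauchy_transform g z - H z"
  proof -
    have "\<forall>\<^sub>F z in ?F. 1 / cnj z \<in> ball 1 s" using inv \<theta> by (intro topological_tendstoD) auto
    moreover have "\<forall>\<^sub>F z in ?F. z \<in> ball 0 1" by (simp add: eventually_at_filter)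
    moreover have "\<forall>\<^sub>F z in ?F. dist z (cis \<theta>) < 1"
      unfolding eventually_at by (intro exI[of _ 1]) auto
    ultimately show ?thesis
    proof eventually_elim
      case (elim z)
      then have "z \<noteq> 0" by auto
      then have "norm (1 / cnj z) > 1" using elim by (simp add: norm_divide)
      then show ?case using H(2)[of "1 / cnj z"] elim by simp
    qed
  qed
  ultimately show ?thesis by (simp add: Lim_transform_eventually)
qed

lemma cap_subset_ball:
  assumes "0 < r" "2 * s < r ^ 2"
  shows "cap s \<subseteq> ball 1 r"
proof
  fix z assume "z \<in> cap s"
  then have "norm (z - 1) ^ 2 < r ^ 2" using cap_norm_le[of z s] assms by linarith
  then show "z \<in> ball 1 r" using assms by (auto simp: dist_norm norm_minus_commute intro: power2_less_imp_less)
qed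

lemma cis_in_cap: "1 - s \<le> cos t \<Longrightarrow> cis t \<in> cap s"
  by (simp add: cap_def)

text \<open>Necessity is the contour deformation in a small \<open>cap\<close>. For sufficiency the
  jump \<open>(cauchy_transform g z - H z) / (2 * pi)\<close> is itself the extension, completed by
  the boundary function on the circle.\<close>

lemma extends_inside_1_iff:
  fixes g :: "real \<Rightarrow> complex"
  assumes g: "continuous_on UNIV g" and per: "\<And>t. g (t + 2 * pi) = g t"
  shows "extends_inside 1 g \<longleftrightarrow> (\<exists>s M. 0 < s \<and> s \<le> 1/2 \<and> geometric_bound s M g)"
proof
  assume "extends_inside 1 g"
  then obtain r L where r: "r > 0" and L: "continuous_on (sphere 0 1 \<union> Pdisk 1 r) L"
     "L holomorphic_on Pdisk 1 r" "agrees_on_arc L g 1 r"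
    unfolding extends_inside_def by auto
  \<comment> \<open>\<open>cap s\<close> lies within distance sqrt (2 s) of 1, so
    \<open>2 * s < r ^ 2\<close> puts it inside \<open>ball 1 r\<close>.\<close>
  define s where "s = min (1/2) (r ^ 2 / 4)"
  have s: "0 < s" "s \<le> 1/2" using r by (auto simp: s_def)
  have "s \<le> r ^ 2 / 4" "0 < r ^ 2" using r by (auto simp: s_def)
  then have "2 * s < r ^ 2" by linarith
  then have cap: "cap s \<subseteq> ball 1 r" using r by (intro cap_subset_ball)
  have "\<exists>M. geometric_bound s M g"
  proof (rule extension_imp_geometric_bound[OF g, of _ L])
    show "continuous_on (cap s) L"
      using cap by (intro continuous_on_subset[OF L(1)]) (auto simp: cap_def Pdisk_def)
    show "L holomorphic_on interior (cap s)"
      using cap interior_subset[of "cap s"] interior_cap[of s]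
      by (intro holomorphic_on_subset[OF L(2)]) (auto simp: Pdisk_def)
    show "L (cis t) = g t" if "1 - s \<le> cos t" for t
      using L(3) cis_in_cap[OF that] cap unfolding agrees_on_arc_def by blast
  qed (use s in auto)
  then show "\<exists>s M. 0 < s \<and> s \<le> 1/2 \<and> geometric_bound s M g" using s by blast
next
  assume "\<exists>s M. 0 < s \<and> s \<le> 1/2 \<and> geometric_bound s M g"
  then obtain s M where s: "0 < s" "s \<le> 1/2" "geometric_bound s M g" by blast
  obtain H where H: "H holomorphic_on ball 1 s" "\<And>z. z \<in> ball 1 s \<Longrightarrow> norm z > 1 \<Longrightarrow> H z = cauchy_transform g z"
    using geometric_bound_imp_continuation[OF g s] by blast
  obtain u where u: "continuous_on (sphere 0 1) u" "\<And>t. u (cis t) = g t"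
    using continuous_on_circle_lift[OF g per] by blast
  let ?K = "\<lambda>z. (cauchy_transform g z - H z) / (2 * pi)"
  define L where "L z = (if norm z < 1 then ?K z else u z)" for z
  \<comment> \<open>Half the radius: circle points in the closure of \<open>Pdisk 1 (s / 2)\<close>
    then lie in \<open>ball 1 s\<close>, where the boundary limit is known. At all other circle
    points there is nothing to approach from inside, so continuity on the whole circle costs nothing
    more.\<close>
  have Khol: "?K holomorphic_on Pdisk 1 (s / 2)"
    using s(1) by (intro holomorphic_intros holomorphic_on_subset[OF cauchy_transform_holomorphic_inside[OF g]]
        holomorphic_on_subset[OF H(1)]) (auto simp: Pdisk_def)
  have LK: "L z = ?K z" if "z \<in> Pdisk 1 (s / 2)" for z using that by (simp add: L_def Pdisk_def)
  have Lhol: "L holomorphic_on Pdisk 1 (s / 2)"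
    using Khol by (rule holomorphic_transform) (simp add: LK)
  have opn: "open (Pdisk 1 (s / 2))" by (auto simp: Pdisk_def)
  have "continuous_on (sphere 0 1 \<union> Pdisk 1 (s / 2)) L"
    unfolding continuous_on_eq_continuous_within
  proof
    fix p assume p: "p \<in> sphere 0 1 \<union> Pdisk 1 (s / 2)"
    show "continuous (at p within sphere 0 1 \<union> Pdisk 1 (s / 2)) L"
    proof (cases "p \<in> Pdisk 1 (s / 2)")
      case True
      then have "isCont L p" using Lhol opn
        by (metis continuous_on_eq_continuous_at holomorphic_on_imp_continuous_on)
      then show ?thesis by (rule continuous_at_imp_continuous_at_within)
    next
      case False
      then have p1: "norm p = 1" using p by auto
      then obtain \<theta> where \<theta>: "p = cis \<theta>" by (metis cis_Arg sgn_eq norm_zero zero_neq_one of_real_1 div_by_1)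
      have "(L \<longlongrightarrow> L p) (at p within sphere 0 1)"
      proof -
        have "(u \<longlongrightarrow> u p) (at p within sphere 0 1)" using u(1) p1 by (auto simp: continuous_on_def)
        moreover have "\<forall>\<^sub>F z in at p within sphere 0 1. u z = L z"
          by (auto simp: eventually_at_filter L_def)
        ultimately have "(L \<longlongrightarrow> u p) (at p within sphere 0 1)" by (rule Lim_transform_eventually)
        moreover have "L p = u p" using p1 by (simp add: L_def)
        ultimately show ?thesis by (simp only:)
      qed
      moreover have "(L \<longlongrightarrow> L p) (at p within Pdisk 1 (s / 2))"
      proof (cases "p \<in> ball 1 s")
        case True
        then have "(?K \<longlongrightarrow> 2 * pi * g \<theta> / (2 * pi)) (at p within ball 0 1)"
          unfolding \<theta> by (intro tendsto_divide tendsto_const continuation_tendsto[OF g per H]) auto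
        then have "(?K \<longlongrightarrow> L p) (at p within ball 0 1)" by (simp add: L_def \<theta> u(2))
        then have "(?K \<longlongrightarrow> L p) (at p within Pdisk 1 (s / 2))"
          by (rule tendsto_within_subset) (auto simp: Pdisk_def)
        moreover have "\<forall>\<^sub>F z in at p within Pdisk 1 (s / 2). ?K z = L z"
          by (auto simp: eventually_at_filter LK)
        ultimately show ?thesis by (rule Lim_transform_eventually)
      next
        case False
        have "closure (Pdisk 1 (s / 2)) \<subseteq> cball 1 (s / 2)"
          by (rule closure_minimal) (auto simp: Pdisk_def)
        then have "p \<notin> closure (Pdisk 1 (s / 2))" using False s by auto
        then show ?thesis by (simp add: not_in_closure_trivial_limitI)
      qed
      ultimately show ?thesis unfolding continuous_within by (rule Lim_Un)
    qed
  qed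
  moreover have "agrees_on_arc L g 1 (s / 2)" by (simp add: agrees_on_arc_def L_def u)
  ultimately show "extends_inside 1 g" unfolding extends_inside_def using s Lhol by (intro exI[of _ "s/2"]) auto
qed

section \<open>Rotation and inversion: every base point and side reduces to the inner side at
  1\<close>

lemma dist_mult_unit:
  assumes "norm c = 1"
  shows "dist (c * z) (c * w) = dist z (w :: complex)"
  using assms by (metis dist_norm mult.left_neutral norm_mult right_diff_distrib)

lemma extends_inside_rotate_imp:
  assumes "extends_inside (cis p) g"
  shows "extends_inside (cis (p - q)) (\<lambda>t. g (q + t))"
proof -
  obtain r L where r: "r > 0" and L: "continuous_on (sphere 0 1 \<union> Pdisk (cis p) r) L"
     "L holomorphic_on Pdisk (cis p) r" "agrees_on_arc L g (cis p) r"
    using assms unfolding extends_inside_def by auto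
  have cp: "cis p = cis q * cis (p - q)" by (simp add: cis_mult)
  have d: "dist (cis p) (cis q * z) = dist (cis (p - q)) z" for z
    unfolding cp by (rule dist_mult_unit) simp
  have "continuous_on (sphere 0 1 \<union> Pdisk (cis (p - q)) r) (\<lambda>z. L (cis q * z))"
    by (rule continuous_on_compose2[OF L(1)]) (auto intro!: continuous_intros simp: Pdisk_def d norm_mult)
  moreover have "(L \<circ> (\<lambda>z. cis q * z)) holomorphic_on Pdisk (cis (p - q)) r"
    by (rule holomorphic_on_compose_gen[OF _ L(2)])
       (auto intro!: holomorphic_intros simp: Pdisk_def d norm_mult)
  moreover have "agrees_on_arc (\<lambda>z. L (cis q * z)) (\<lambda>t. g (q + t)) (cis (p - q)) r"
    unfolding agrees_on_arc_def
  proof (intro allI impI)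
    fix t assume "cis t \<in> ball (cis (p - q)) r"
    then have "cis (q + t) \<in> ball (cis p) r" using d[of "cis t"] by (simp add: cis_mult)
    then show "L (cis q * cis t) = g (q + t)"
      using L(3) unfolding agrees_on_arc_def by (simp add: cis_mult)
  qed
  ultimately show ?thesis unfolding extends_inside_def o_def using r by blast
qed

lemma extends_inside_cis_iff: "extends_inside (cis p) g \<longleftrightarrow> extends_inside 1 (\<lambda>t. g (p + t))"
  using extends_inside_rotate_imp[of p g p] extends_inside_rotate_imp[of 0 "\<lambda>t. g (p + t)" "-p"]
  by auto

lemma extends_across_rotate_imp:
  assumes "extends_across (cis p) g"
  shows "extends_across (cis (p - q)) (\<lambda>t. g (q + t))"
proof -
  obtain r L where r: "r > 0" and L: "L holomorphic_on ball (cis p) r" "agrees_on_arc L g (cis p) r"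
    using assms unfolding extends_across_def by auto
  have cp: "cis p = cis q * cis (p - q)" by (simp add: cis_mult)
  have d: "dist (cis p) (cis q * z) = dist (cis (p - q)) z" for z
    unfolding cp by (rule dist_mult_unit) simp
  have "(L \<circ> (\<lambda>z. cis q * z)) holomorphic_on ball (cis (p - q)) r"
    by (rule holomorphic_on_compose_gen[OF _ L(1)]) (auto intro!: holomorphic_intros simp: d)
  moreover have "agrees_on_arc (\<lambda>z. L (cis q * z)) (\<lambda>t. g (q + t)) (cis (p - q)) r"
    unfolding agrees_on_arc_def
  proof (intro allI impI)
    fix t assume "cis t \<in> ball (cis (p - q)) r"
    then have "cis (q + t) \<in> ball (cis p) r" using d[of "cis t"] by (simp add: cis_mult)
    then show "L (cis q * cis t) = g (q + t)"
      using L(2) unfolding agrees_on_arc_def by (simp add: cis_mult)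
  qed
  ultimately show ?thesis unfolding extends_across_def o_def using r by blast
qed

lemma extends_across_cis_iff: "extends_across (cis p) g \<longleftrightarrow> extends_across 1 (\<lambda>t. g (p + t))"
  using extends_across_rotate_imp[of p g p] extends_across_rotate_imp[of 0 "\<lambda>t. g (p + t)" "-p"]
  by auto

text \<open>Near 1, inversion at most doubles the distance to 1; this is the source of the halved
  radii below.\<close>

lemma near_1:
  fixes z :: complex
  assumes "norm (z - 1) < 1 / 2"
  shows "1 / 2 < norm z" "z \<noteq> 0" "norm (1 / z - 1) \<le> 2 * norm (z - 1)"
proof -
  show "1 / 2 < norm z" using assms norm_triangle_ineq2[of 1 "1 - z"] by (simp add: norm_minus_commute)
  then show z0: "z \<noteq> 0" by auto
  have "norm (1 / z - 1) = norm (z - 1) / norm z"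
    using z0 by (simp add: norm_minus_commute[of z] diff_divide_distrib flip: norm_divide)
  also have "\<dots> \<le> norm (z - 1) / (1 / 2)"
    using \<open>1 / 2 < norm z\<close> by (intro divide_left_mono) auto
  finally show "norm (1 / z - 1) \<le> 2 * norm (z - 1)" by simp
qed

text \<open>The substitution \<open>z \<mapsto> cis p / z\<close> exchanges the sides, sends
  \<open>cis p\<close> to 1 and reverses orientation, hence \<open>p - t\<close>.\<close>

lemma extends_outside_cis_iff: "extends_outside (cis p) g \<longleftrightarrow> extends_inside 1 (\<lambda>t. g (p - t))"
proof
  assume "extends_outside (cis p) g"
  then obtain r L where r: "r > 0" and L: "continuous_on (sphere 0 1 \<union> Omega (cis p) r) L"
     "L holomorphic_on Omega (cis p) r" "agrees_on_arc L g (cis p) r"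
    unfolding extends_outside_def by auto
  define r' where "r' = min (1/2) (r/2)"
  have r': "r' > 0" "r' \<le> 1/2" "2 * r' \<le> r" using r by (auto simp: r'_def)
  have nz: "z \<noteq> 0" and ball: "cis p / z \<in> ball (cis p) r" if "z \<in> ball 1 r'" for z
  proof -
    have *: "norm (z - 1) < r'" using that by (simp add: dist_norm norm_minus_commute)
    then show "z \<noteq> 0" using r' near_1(2)[of z] by auto
    have "dist (cis p) (cis p / z) = norm (1 / z - 1)"
      using dist_mult_unit[of "cis p" 1 "1 / z"] by (simp add: dist_norm norm_minus_commute)
    then show "cis p / z \<in> ball (cis p) r" using near_1(3)[of z] * r' by auto
  qed
  have P: "cis p / z \<in> Omega (cis p) r" if "z \<in> Pdisk 1 r'" for z
    using that ball[of z] nz[of z] by (auto simp: Pdisk_def Omega_def norm_divide)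
  have z0: "z \<noteq> 0" if "z \<in> sphere 0 1 \<union> Pdisk 1 r'" for z
    using that nz by (auto simp: Pdisk_def)
  have "continuous_on (sphere 0 1 \<union> Pdisk 1 r') (\<lambda>z. L (cis p / z))"
    using P z0 by (intro continuous_on_compose2[OF L(1)]) (auto intro!: continuous_intros simp: norm_divide)
  moreover have "(L \<circ> (\<lambda>z. cis p / z)) holomorphic_on Pdisk 1 r'"
    using P z0 by (intro holomorphic_on_compose_gen[OF _ L(2)]) (auto intro!: holomorphic_intros)
  moreover have "agrees_on_arc (\<lambda>z. L (cis p / z)) (\<lambda>t. g (p - t)) 1 r'"
    unfolding agrees_on_arc_def
  proof (intro allI impI)
    fix t assume "cis t \<in> ball 1 r'"
    then have "cis (p - t) \<in> ball (cis p) r" using ball[of "cis t"] by (simp add: cis_divide)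
    then show "L (cis p / cis t) = g (p - t)"
      using L(3) unfolding agrees_on_arc_def by (simp add: cis_divide)
  qed
  ultimately show "extends_inside 1 (\<lambda>t. g (p - t))"
    unfolding extends_inside_def o_def using r' by blast
next
  assume "extends_inside 1 (\<lambda>t. g (p - t))"
  then obtain r L where r: "r > 0" and L: "continuous_on (sphere 0 1 \<union> Pdisk 1 r) L"
     "L holomorphic_on Pdisk 1 r" "agrees_on_arc L (\<lambda>t. g (p - t)) 1 r"
    unfolding extends_inside_def by auto
  \<comment> \<open>No shrinking in this direction: outside the disc, division by
    \<open>norm z \<ge> 1\<close> only decreases distances.\<close>
  have ball: "cis p / z \<in> ball 1 r" if "z \<in> ball (cis p) r" "1 \<le> norm z" for z
  proof -
    have "z \<noteq> 0" using that by auto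
    then have "dist 1 (cis p / z) = dist (cis p) z / norm z"
      by (simp add: dist_norm norm_minus_commute divide_simps flip: norm_divide)
    also have "\<dots> \<le> dist (cis p) z" using that by (simp add: divide_le_eq mult_le_cancel_left1)
    finally show ?thesis using that by simp
  qed
  have P: "cis p / z \<in> Pdisk 1 r" if "z \<in> Omega (cis p) r" for z
    using that ball[of z] by (auto simp: Pdisk_def Omega_def norm_divide divide_less_eq)
  have z0: "z \<noteq> 0" if "z \<in> sphere 0 1 \<union> Omega (cis p) r" for z
    using that by (auto simp: Omega_def)
  have "continuous_on (sphere 0 1 \<union> Omega (cis p) r) (\<lambda>z. L (cis p / z))"
    using P z0 by (intro continuous_on_compose2[OF L(1)]) (auto intro!: continuous_intros simp: norm_divide)
  moreover have "(L \<circ> (\<lambda>z. cis p / z)) holomorphic_on Omega (cis p) r"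
    using P z0 by (intro holomorphic_on_compose_gen[OF _ L(2)]) (auto intro!: holomorphic_intros)
  moreover have "agrees_on_arc (\<lambda>z. L (cis p / z)) g (cis p) r"
    unfolding agrees_on_arc_def
  proof (intro allI impI)
    fix t assume "cis t \<in> ball (cis p) r"
    then have "cis (p - t) \<in> ball 1 r" using ball[of "cis t"] by (simp add: cis_divide)
    then show "L (cis p / cis t) = g t" using L(3) unfolding agrees_on_arc_def by (auto simp: cis_divide)
  qed
  ultimately show "extends_outside (cis p) g"
    unfolding extends_outside_def o_def using r by blast
qed

text \<open>On the circle the kernel at \<open>1 / z\<close>, with \<open>t\<close> reversed, is 1
  minus the kernel at \<open>z\<close>. So a continuation of the exterior transform of the reflected
  function is, up to a constant, one of the interior transform of \<open>g\<close>.\<close>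

lemma cauchy_transform_reflect:
  fixes g :: "real \<Rightarrow> complex"
  assumes g: "continuous_on UNIV g" and z: "z \<noteq> 0" "norm z \<noteq> 1"
  shows "cauchy_transform (\<lambda>t. g (- t)) (1 / z) = integral {-pi..pi} g - cauchy_transform g z"
proof -
  have ne: "cis t \<noteq> z" for t using z by auto
  have "cis (-t) / (cis (-t) - 1 / z) = 1 - cis t / (cis t - z)" for t
    using z ne[of t] by (simp add: divide_simps flip: cis_inverse) (simp add: algebra_simps)
  then have eq: "g t * cis (-t) / (cis (-t) - 1 / z) = g t - g t * cis t / (cis t - z)" for t
    by (metis mult.right_neutral right_diff_distrib times_divide_eq_right)
  have "cauchy_transform (\<lambda>t. g (- t)) (1 / z) = integral {- pi..- (- pi)} (\<lambda>t. g (- t) * cis (- (- t)) / (cis (- (- t)) - 1 / z))"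
    by (simp add: cauchy_transform_def)
  also have "\<dots> = integral {-pi..pi} (\<lambda>t. g t * cis (- t) / (cis (- t) - 1 / z))"
    using Henstock_Kurzweil_Integration.integral_reflect_real[of pi "-pi" "\<lambda>t. g t * cis (- t) / (cis (- t) - 1 / z)"] by simp
  also have "\<dots> = integral {-pi..pi} (\<lambda>t. g t - g t * cis t / (cis t - z))"
    by (simp only: eq)
  also have "\<dots> = integral {-pi..pi} g - cauchy_transform g z"
    unfolding cauchy_transform_def
    using z by (intro integral_diff integrable_continuous_real cauchy_transform_integrable g)
      (auto intro: continuous_on_subset[OF g])
  finally show ?thesis .
qed

lemma extends_across_reflect:
  assumes "extends_across 1 g"
  shows "extends_across 1 (\<lambda>t. g (- t))"
proof -
  obtain r L where r: "r > 0" and L: "L holomorphic_on ball 1 r" "agrees_on_arc L g 1 r"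
    using assms unfolding extends_across_def by auto
  define r' where "r' = min (1/2) (r/2)"
  have r': "r' > 0" "r' \<le> 1/2" "2 * r' \<le> r" using r by (auto simp: r'_def)
  have nz: "z \<noteq> 0" and ball: "1 / z \<in> ball 1 r" if "z \<in> ball 1 r'" for z :: complex
    using that near_1[of z] r' by (auto simp: dist_norm norm_minus_commute)
  have "(L \<circ> (\<lambda>z. 1 / z)) holomorphic_on ball 1 r'"
    using nz ball r'(2) by (intro holomorphic_on_compose_gen[OF _ L(1)]) (auto intro!: holomorphic_intros)
  moreover have "agrees_on_arc (\<lambda>z. L (1 / z)) (\<lambda>t. g (- t)) 1 r'"
    unfolding agrees_on_arc_def
  proof (intro allI impI)
    fix t assume "cis t \<in> ball 1 r'"
    then have "1 / cis t \<in> ball 1 r" by (rule ball)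
    moreover have "1 / cis t = cis (- t)" by (simp add: inverse_eq_divide flip: cis_inverse)
    ultimately show "L (1 / cis t) = g (- t)" using L(2) unfolding agrees_on_arc_def by metis
  qed
  ultimately show ?thesis unfolding extends_across_def o_def using r' by blast
qed

text \<open>The function \<open>L\<close> is controlled only near 1, while
  \<open>extends_inside\<close> demands continuity on the whole circle. The detour through the
  coefficient bound produces an extension of the required kind.\<close>

lemma extends_across_imp_inside:
  fixes g :: "real \<Rightarrow> complex"
  assumes g: "continuous_on UNIV g" and per: "\<And>t. g (t + 2 * pi) = g t" and "extends_across 1 g"
  shows "extends_inside 1 g"
proof -
  obtain r L where r: "r > 0" and L: "L holomorphic_on ball 1 r" "agrees_on_arc L g 1 r"
    using assms unfolding extends_across_def by auto
  define s where "s = min (1/2) (r ^ 2 / 4)"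
  have s: "0 < s" "s \<le> 1/2" using r by (auto simp: s_def)
  have "s \<le> r ^ 2 / 4" "0 < r ^ 2" using r by (auto simp: s_def)
  then have "2 * s < r ^ 2" by linarith
  then have cap: "cap s \<subseteq> ball 1 r" using r by (intro cap_subset_ball)
  have "\<exists>M. geometric_bound s M g"
  proof (rule extension_imp_geometric_bound[OF g, of _ L])
    show "continuous_on (cap s) L"
      using cap L(1) holomorphic_on_imp_continuous_on holomorphic_on_subset by blast
    show "L holomorphic_on interior (cap s)"
      using cap L(1) interior_subset[of "cap s"] holomorphic_on_subset by blast
    show "L (cis t) = g t" if "1 - s \<le> cos t" for t
      using L(2) cis_in_cap[OF that] cap unfolding agrees_on_arc_def by blast
  qed (use s in auto)
  then show ?thesis unfolding extends_inside_1_iff[OF g per] using s by blast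
qed

lemma periodic_reflect:
  fixes g :: "real \<Rightarrow> 'a"
  assumes "\<And>t. g (t + 2 * pi) = g t"
  shows "g (p - (t + 2 * pi)) = g (p - t)"
  using assms[of "p - (t + 2 * pi)"] by (simp add: algebra_simps)

text \<open>If the exterior Cauchy transform continues to \<open>H\<close> and, after reflection, the interior one
  to \<open>\<integral>g - H'(1/z)\<close>, then the jump \<open>(\<integral>g - H'(1/z) - H(z)) / 2\<pi>\<close> is the required extension.\<close>

lemma extends_across_1_iff:
  fixes g :: "real \<Rightarrow> complex"
  assumes g: "continuous_on UNIV g" and per: "\<And>t. g (t + 2 * pi) = g t"
  shows "extends_across 1 g \<longleftrightarrow> extends_inside 1 g \<and> extends_inside 1 (\<lambda>t. g (- t))"
proof -
  have g': "continuous_on UNIV (\<lambda>t. g (- t))"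
    by (rule continuous_on_compose2[OF g]) (auto intro!: continuous_intros)
  have per': "g (- (t + 2 * pi)) = g (- t)" for t using periodic_reflect[of g 0 t, OF per] by simp
  show ?thesis
  proof
    assume "extends_across 1 g"
    then show "extends_inside 1 g \<and> extends_inside 1 (\<lambda>t. g (- t))"
      using extends_across_imp_inside[OF g per] extends_across_imp_inside[OF g' per'] extends_across_reflect by blast
  next
    assume "extends_inside 1 g \<and> extends_inside 1 (\<lambda>t. g (- t))"
    then obtain s M s' M' where s: "0 < s" "s \<le> 1/2" "geometric_bound s M g"
       and s': "0 < s'" "s' \<le> 1/2" "geometric_bound s' M' (\<lambda>t. g (- t))"
      unfolding extends_inside_1_iff[OF g per] extends_inside_1_iff[OF g' per'] by blast
    obtain H where H: "H holomorphic_on ball 1 s" "\<And>z. z \<in> ball 1 s \<Longrightarrow> norm z > 1 \<Longrightarrow> H z = cauchy_transform g z"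
      using geometric_bound_imp_continuation[OF g s] by blast
    obtain H' where H': "H' holomorphic_on ball 1 s'"
        "\<And>z. z \<in> ball 1 s' \<Longrightarrow> norm z > 1 \<Longrightarrow> H' z = cauchy_transform (\<lambda>t. g (- t)) z"
      using geometric_bound_imp_continuation[OF g' s'] by blast
    define r where "r = min s (s' / 2)"
    have r: "0 < r" "r \<le> s" "2 * r \<le> s'" "r \<le> 1/2" using s s' by (auto simp: r_def)
    have nz: "z \<noteq> 0" and ball: "1 / z \<in> ball 1 s'" if "z \<in> ball 1 r" for z :: complex
      using that near_1[of z] r by (auto simp: dist_norm norm_minus_commute)
    define F where "F z = (integral {-pi..pi} g - H' (1 / z) - H z) / (2 * pi)" for z
    have "(H' \<circ> (\<lambda>z. 1 / z)) holomorphic_on ball 1 r"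
      using nz ball r(4) by (intro holomorphic_on_compose_gen[OF _ H'(1)]) (auto intro!: holomorphic_intros)
    then have Fhol: "F holomorphic_on ball 1 r"
      unfolding F_def[abs_def] o_def using r
      by (intro holomorphic_intros holomorphic_on_subset[OF H(1)]) auto
    \<comment> \<open>Inside the disc \<open>F\<close> is the jump quotient, with boundary value
      \<open>g \<theta>\<close>. Since \<open>F\<close> is continuous at
      \<open>cis \<theta>\<close>, approach from the inner side already determines its value
      there.\<close>
    have "agrees_on_arc F g 1 r"
      unfolding agrees_on_arc_def
    proof (intro allI impI)
      fix \<theta> assume \<theta>: "cis \<theta> \<in> ball 1 r"
      let ?F = "at (cis \<theta>) within ball 0 1"
      have "isCont F (cis \<theta>)"
        using Fhol \<theta> by (metis continuous_on_eq_continuous_at holomorphic_on_imp_continuous_on open_ball)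
      then have F1: "(F \<longlongrightarrow> F (cis \<theta>)) ?F" using isCont_tendsto_compose[OF _ tendsto_ident_at] by auto
      have "((\<lambda>z. (cauchy_transform g z - H z) / (2 * pi)) \<longlongrightarrow> 2 * pi * g \<theta> / (2 * pi)) ?F"
        using \<theta> r by (intro tendsto_divide tendsto_const continuation_tendsto[OF g per H]) auto
      moreover have "\<forall>\<^sub>F z in ?F. (cauchy_transform g z - H z) / (2 * pi) = F z"
      proof -
        have "\<forall>\<^sub>F z in ?F. z \<in> ball 1 r" using \<theta> by (intro topological_tendstoD[OF tendsto_ident_at]) auto
        moreover have "\<forall>\<^sub>F z in ?F. z \<in> ball 0 1" by (simp add: eventually_at_filter)
        ultimately show ?thesis
        proof eventually_elim
          case (elim z)
          then have z: "z \<noteq> 0" "norm z < 1" "1 / z \<in> ball 1 s'" using nz ball by auto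
          then have "H' (1 / z) = integral {-pi..pi} g - cauchy_transform g z"
            using H'(2)[of "1 / z"] cauchy_transform_reflect[OF g, of z] by (simp add: norm_divide)
          then show ?case by (simp add: F_def)
        qed
      qed
      ultimately have "(F \<longlongrightarrow> 2 * pi * g \<theta> / (2 * pi)) ?F" by (rule Lim_transform_eventually)
      moreover have "?F \<noteq> bot" by (simp add: at_within_ball_bot_iff)
      ultimately show "F (cis \<theta>) = g \<theta>" using F1 tendsto_unique by fastforce
    qed
    then show "extends_across 1 g" unfolding extends_across_def using r Fhol by blast
  qed
qed

section \<open>Reduction to countably many base points and constants\<close>

lemma Pdisk_mono: "ball z1 r1 \<subseteq> ball z0 r0 \<Longrightarrow> Pdisk z1 r1 \<subseteq> Pdisk z0 r0"
  by (auto simp: Pdisk_def)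

lemma Omega_mono: "ball z1 r1 \<subseteq> ball z0 r0 \<Longrightarrow> Omega z1 r1 \<subseteq> Omega z0 r0"
  by (auto simp: Omega_def)

lemma agrees_on_arc_mono: "agrees_on_arc F g z0 r0 \<Longrightarrow> ball z1 r1 \<subseteq> ball z0 r0 \<Longrightarrow> agrees_on_arc F g z1 r1"
  by (auto simp: agrees_on_arc_def)

lemma ball_subset_ball_dist: "ball z1 (r - dist z0 z1) \<subseteq> ball z0 r"
proof
  fix z assume "z \<in> ball z1 (r - dist z0 z1)"
  then show "z \<in> ball z0 r" using dist_triangle[of z0 z z1] by simp
qed

text \<open>Extendability is open in the base point, since the ball of radius
  \<open>r - dist z0 z1\<close> about \<open>z1\<close> fits into the old one. If it occurs
  anywhere, it thus occurs at a dyadic point.\<close>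

lemma extends_inside_nearby:
  assumes "extends_inside z0 g"
  obtains r where "r > 0" "\<And>z1. z1 \<in> ball z0 r \<Longrightarrow> extends_inside z1 g"
proof -
  obtain r L where r: "r > 0" and L: "continuous_on (sphere 0 1 \<union> Pdisk z0 r) L"
     "L holomorphic_on Pdisk z0 r" "agrees_on_arc L g z0 r"
    using assms unfolding extends_inside_def by auto
  have "extends_inside z1 g" if "z1 \<in> ball z0 r" for z1
  proof -
    have sub: "ball z1 (r - dist z0 z1) \<subseteq> ball z0 r" by (rule ball_subset_ball_dist)
    have "continuous_on (sphere 0 1 \<union> Pdisk z1 (r - dist z0 z1)) L"
      using Pdisk_mono[OF sub] by (intro continuous_on_subset[OF L(1)]) auto
    moreover have "L holomorphic_on Pdisk z1 (r - dist z0 z1)"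
      using L(2) Pdisk_mono[OF sub] by (rule holomorphic_on_subset)
    ultimately show ?thesis using agrees_on_arc_mono[OF L(3) sub] that
      unfolding extends_inside_def by (intro exI[of _ "r - dist z0 z1"]) auto
  qed
  with r that show ?thesis by blast
qed

lemma extends_outside_nearby:
  assumes "extends_outside z0 g"
  obtains r where "r > 0" "\<And>z1. z1 \<in> ball z0 r \<Longrightarrow> extends_outside z1 g"
proof -
  obtain r L where r: "r > 0" and L: "continuous_on (sphere 0 1 \<union> Omega z0 r) L"
     "L holomorphic_on Omega z0 r" "agrees_on_arc L g z0 r"
    using assms unfolding extends_outside_def by auto
  have "extends_outside z1 g" if "z1 \<in> ball z0 r" for z1
  proof -
    have sub: "ball z1 (r - dist z0 z1) \<subseteq> ball z0 r" by (rule ball_subset_ball_dist)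
    have "continuous_on (sphere 0 1 \<union> Omega z1 (r - dist z0 z1)) L"
      using Omega_mono[OF sub] by (intro continuous_on_subset[OF L(1)]) auto
    moreover have "L holomorphic_on Omega z1 (r - dist z0 z1)"
      using L(2) Omega_mono[OF sub] by (rule holomorphic_on_subset)
    ultimately show ?thesis using agrees_on_arc_mono[OF L(3) sub] that
      unfolding extends_outside_def by (intro exI[of _ "r - dist z0 z1"]) auto
  qed
  with r that show ?thesis by blast
qed

lemma extends_across_nearby:
  assumes "extends_across z0 g"
  obtains r where "r > 0" "\<And>z1. z1 \<in> ball z0 r \<Longrightarrow> extends_across z1 g"
proof -
  obtain r L where r: "r > 0" and L: "L holomorphic_on ball z0 r" "agrees_on_arc L g z0 r"
    using assms unfolding extends_across_def by auto
  have "extends_across z1 g" if "z1 \<in> ball z0 r" for z1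
  proof -
    have sub: "ball z1 (r - dist z0 z1) \<subseteq> ball z0 r" by (rule ball_subset_ball_dist)
    show ?thesis using agrees_on_arc_mono[OF L(2) sub] holomorphic_on_subset[OF L(1) sub] that
      unfolding extends_across_def by (intro exI[of _ "r - dist z0 z1"]) auto
  qed
  with r that show ?thesis by blast
qed

text \<open>Dyadic angles are chosen for the lacunary series: multiplied by \<open>2 ^ i\<close>
  with \<open>i \<ge> j\<close>, the angle becomes a multiple of \<open>2 * pi\<close>.\<close>

definition dyadic_angle :: "int \<Rightarrow> nat \<Rightarrow> real" where
  "dyadic_angle p j = 2 * pi * p / 2 ^ j"

lemma dyadic_angles_dense:
  assumes "z0 \<in> sphere 0 1" "r > 0"
  obtains p j where "cis (dyadic_angle p j) \<in> ball z0 r"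
proof -
  obtain \<theta> where \<theta>: "z0 = cis \<theta>"
    using assms by (metis cis_Arg sgn_eq norm_zero zero_neq_one of_real_1 div_by_1 mem_sphere_0)
  define p where "p j = \<lfloor>\<theta> * 2 ^ j / (2 * pi)\<rfloor>" for j :: nat
  have b: "norm (dyadic_angle (p j) j - \<theta>) \<le> 2 * pi * (1/2) ^ j" for j
  proof -
    have "of_int (p j) \<le> \<theta> * 2 ^ j / (2 * pi)" "\<theta> * 2 ^ j / (2 * pi) < of_int (p j) + 1"
      unfolding p_def by linarith+
    then have "\<bar>2 * pi * p j - \<theta> * 2 ^ j\<bar> \<le> 2 * pi"
      by (simp add: abs_le_iff field_simps)
    then have "\<bar>2 * pi * p j - \<theta> * 2 ^ j\<bar> / 2 ^ j \<le> 2 * pi / 2 ^ j"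
      by (intro divide_right_mono) auto
    moreover have "dyadic_angle (p j) j - \<theta> = (2 * pi * p j - \<theta> * 2 ^ j) / 2 ^ j"
      by (simp add: dyadic_angle_def diff_divide_distrib)
    ultimately show ?thesis by (simp add: power_one_over divide_simps)
  qed
  have lim: "(\<lambda>j. 2 * pi * (1/2) ^ j) \<longlonglongrightarrow> 0"
    by (intro tendsto_mult_right_zero LIMSEQ_power_zero) auto
  have "(\<lambda>j. dyadic_angle (p j) j - \<theta>) \<longlonglongrightarrow> 0"
    by (rule Lim_null_comparison[OF always_eventually[OF allI[OF b]] lim])
  then have "(\<lambda>j. dyadic_angle (p j) j) \<longlonglongrightarrow> \<theta>" by (simp add: LIM_zero_iff)
  then have "(\<lambda>j. cis (dyadic_angle (p j) j)) \<longlonglongrightarrow> cis \<theta>"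
    unfolding cis_conv_exp by (intro tendsto_intros)
  then have "\<forall>\<^sub>F j in sequentially. cis (dyadic_angle (p j) j) \<in> ball z0 r"
    using assms \<theta> by (intro topological_tendstoD) auto
  then show ?thesis using that by (auto simp: eventually_sequentially)
qed

text \<open>Bounds are monotone in both constants, so countably many pairs suffice. The offset 2
  keeps the radius parameter in the range up to 1/2 required for continuation.\<close>

lemma geometric_bound_nat_iff:
  "(\<exists>s M. 0 < s \<and> s \<le> 1/2 \<and> geometric_bound s M g) \<longleftrightarrow>
   (\<exists>m M. geometric_bound (1 / (real m + 2)) (real M) g)"
proof
  assume "\<exists>s M. 0 < s \<and> s \<le> 1/2 \<and> geometric_bound s M g"
  then obtain s M where s: "0 < s" "geometric_bound s M g" by blast
  obtain m where m: "inverse (real (Suc m)) < s" using reals_Archimedean[OF s(1)] by blast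
  have "1 / (real m + 2) \<le> inverse (real (Suc m))" by (simp add: field_simps)
  moreover obtain N where "M \<le> real N" using real_arch_simple by blast
  ultimately show "\<exists>m M. geometric_bound (1 / (real m + 2)) (real M) g"
    using geometric_bound_mono[OF s(2), of "1 / (real m + 2)" "real N"] m by fastforce
next
  assume "\<exists>m M. geometric_bound (1 / (real m + 2)) (real M) g"
  then obtain m M where "geometric_bound (1 / (real m + 2)) (real M) g" by blast
  moreover have "0 < 1 / (real m + 2)" "1 / (real m + 2) \<le> 1/2" by (auto simp: field_simps)
  ultimately show "\<exists>s M. 0 < s \<and> s \<le> 1/2 \<and> geometric_bound s M g" by blast
qed

text \<open>\<open>\<sigma>\<close> is 1 for the inner side and -1 for the outer one, so that
  openness and the line argument are proved once for both.\<close>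

definition shift_bounded :: "real \<Rightarrow> real \<Rightarrow> nat \<Rightarrow> nat \<Rightarrow> (real \<Rightarrow> complex) \<Rightarrow> bool" where
  "shift_bounded \<sigma> q m M g \<longleftrightarrow> geometric_bound (1 / (real m + 2)) (real M) (\<lambda>t. g (q + \<sigma> * t))"

context
  fixes g :: "real \<Rightarrow> complex"
  assumes g: "continuous_on UNIV g" and per: "\<And>t. g (t + 2 * pi) = g t"
begin

lemma continuous_shift: "continuous_on UNIV (\<lambda>t. g (p + t))"
  by (rule continuous_on_compose2[OF g]) (auto intro!: continuous_intros)

lemma continuous_shift': "continuous_on UNIV (\<lambda>t. g (p - t))"
  by (rule continuous_on_compose2[OF g]) (auto intro!: continuous_intros)

lemma periodic_shift: "g (p + (t + 2 * pi)) = g (p + t)"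
  using per[of "p + t"] by (simp add: algebra_simps)

lemma inside_cis_iff_bounded:
  "extends_inside (cis p) g \<longleftrightarrow> (\<exists>m M. shift_bounded 1 p m M g)"
  unfolding extends_inside_cis_iff extends_inside_1_iff[OF continuous_shift periodic_shift]
    geometric_bound_nat_iff shift_bounded_def by simp

lemma outside_cis_iff_bounded:
  "extends_outside (cis p) g \<longleftrightarrow> (\<exists>m M. shift_bounded (-1) p m M g)"
  unfolding extends_outside_cis_iff extends_inside_1_iff[OF continuous_shift' periodic_reflect[of g, OF per]]
    geometric_bound_nat_iff shift_bounded_def by simp

lemma across_cis_iff:
  "extends_across (cis p) g \<longleftrightarrow> extends_inside (cis p) g \<and> extends_outside (cis p) g"
  unfolding extends_across_cis_iff extends_inside_cis_iff extends_outside_cis_iff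
    extends_across_1_iff[OF continuous_shift periodic_shift] by simp

lemma somewhere_inside_iff:
  "(\<exists>z0\<in>sphere 0 1. extends_inside z0 g) \<longleftrightarrow> (\<exists>p j m M. shift_bounded 1 (dyadic_angle p j) m M g)"
proof -
  have "(\<exists>z0\<in>sphere 0 1. extends_inside z0 g) \<longleftrightarrow> (\<exists>p j. extends_inside (cis (dyadic_angle p j)) g)"
    by (metis extends_inside_nearby dyadic_angles_dense norm_cis mem_sphere_0)
  then show ?thesis by (simp add: inside_cis_iff_bounded)
qed

lemma somewhere_outside_iff:
  "(\<exists>z0\<in>sphere 0 1. extends_outside z0 g) \<longleftrightarrow> (\<exists>p j m M. shift_bounded (-1) (dyadic_angle p j) m M g)"
proof -
  have "(\<exists>z0\<in>sphere 0 1. extends_outside z0 g) \<longleftrightarrow> (\<exists>p j. extends_outside (cis (dyadic_angle p j)) g)"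
    by (metis extends_outside_nearby dyadic_angles_dense norm_cis mem_sphere_0)
  then show ?thesis by (simp add: outside_cis_iff_bounded)
qed

lemma somewhere_across_iff:
  "(\<exists>z0\<in>sphere 0 1. extends_across z0 g) \<longleftrightarrow>
   (\<exists>p j m M m' M'. shift_bounded 1 (dyadic_angle p j) m M g \<and> shift_bounded (-1) (dyadic_angle p j) m' M' g)"
proof -
  have "(\<exists>z0\<in>sphere 0 1. extends_across z0 g) \<longleftrightarrow> (\<exists>p j. extends_across (cis (dyadic_angle p j)) g)"
    by (metis extends_across_nearby dyadic_angles_dense norm_cis mem_sphere_0)
  then show ?thesis by (simp add: across_cis_iff inside_cis_iff_bounded outside_cis_iff_bounded)
qed

end

section \<open>The topology of \<open>C\<^sup>k(T)\<close>\<close>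

lemma Ck_periodic: "g \<in> Ck k \<Longrightarrow> g (t + 2 * pi) = g t"
  by (simp add: Ck_def)

lemma Ck_dtheta_continuous: "g \<in> Ck k \<Longrightarrow> enat l \<le> k \<Longrightarrow> continuous_on UNIV (dtheta l g)"
  by (simp add: Ck_def)

lemma Ck_dtheta_differentiable: "g \<in> Ck k \<Longrightarrow> enat (Suc l) \<le> k \<Longrightarrow> dtheta l g differentiable (at x)"
  by (simp add: Ck_def)

lemma Ck_continuous: "g \<in> Ck k \<Longrightarrow> continuous_on UNIV g"
  using Ck_dtheta_continuous[of g k 0] by (simp flip: zero_enat_def)

lemma enat_Suc_leD: "enat (Suc l) \<le> k \<Longrightarrow> enat l \<le> k"
  by (meson Suc_ile_eq order_less_imp_le)

lemma Ck_dtheta_periodic: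
  assumes "g \<in> Ck k" "enat l \<le> k"
  shows "dtheta l g (t + 2 * pi) = dtheta l g t"
  using assms(2)
proof (induction l arbitrary: t)
  case 0
  show ?case using Ck_periodic[OF assms(1)] by simp
next
  case (Suc l)
  let ?D = "vector_derivative (dtheta l g) (at (t + 2 * pi))"
  have "(dtheta l g has_vector_derivative ?D) (at (t + 2 * pi))"
    using Ck_dtheta_differentiable[OF assms(1) Suc.prems] vector_derivative_works by blast
  then have "(dtheta l g \<circ> (\<lambda>t. t + 2 * pi) has_vector_derivative 1 *\<^sub>R ?D) (at t)"
    by (intro vector_diff_chain_at) (auto intro!: derivative_eq_intros)
  moreover have "dtheta l g \<circ> (\<lambda>t. t + 2 * pi) = dtheta l g"
    using Suc.IH[OF enat_Suc_leD[OF Suc.prems]] by auto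
  ultimately show ?case by (simp add: vector_derivative_at)
qed

lemma Ck_dtheta_bounded:
  assumes "g \<in> Ck k" "enat l \<le> k"
  obtains B where "0 < B" "\<And>t. norm (dtheta l g t) \<le> B"
  using periodic_continuous_bounded[of "dtheta l g", OF Ck_dtheta_continuous[OF assms] Ck_dtheta_periodic[OF assms]]
  by blast

lemma dtheta_add:
  assumes "f \<in> Ck k" "h \<in> Ck k" "enat l \<le> k"
  shows "dtheta l (\<lambda>x. f x + c * h x) = (\<lambda>x. dtheta l f x + c * dtheta l h x)"
  using assms(3)
proof (induction l)
  case (Suc l)
  have "dtheta l f differentiable (at x)" "dtheta l h differentiable (at x)" for x
    using Ck_dtheta_differentiable assms Suc.prems by blast+
  then show ?case
    unfolding dtheta.simps Suc.IH[OF enat_Suc_leD[OF Suc.prems]] by (simp add: fun_eq_iff)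
qed simp

lemma Ck_add:
  assumes "f \<in> Ck k" "h \<in> Ck k"
  shows "(\<lambda>x. f x + c * h x) \<in> Ck k"
proof -
  have "continuous_on UNIV (dtheta l (\<lambda>x. f x + c * h x))" if "enat l \<le> k" for l
    unfolding dtheta_add[OF assms that]
    using Ck_dtheta_continuous[OF _ that] assms by (intro continuous_intros) auto
  moreover have "dtheta l (\<lambda>x. f x + c * h x) differentiable (at x)" if "enat (Suc l) \<le> k" for l x
    unfolding dtheta_add[OF assms enat_Suc_leD[OF that]]
    using Ck_dtheta_differentiable[OF _ that] assms
    by (intro differentiable_add differentiable_mult differentiable_const) auto
  moreover have "f (\<theta> + 2 * pi) + c * h (\<theta> + 2 * pi) = f \<theta> + c * h \<theta>" for \<theta>
    using assms by (simp add: Ck_periodic)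
  ultimately show ?thesis unfolding Ck_def by simp
qed

definition sup_dist :: "nat \<Rightarrow> (real \<Rightarrow> complex) \<Rightarrow> (real \<Rightarrow> complex) \<Rightarrow> real" where
  "sup_dist l g f = (SUP \<theta>. norm (dtheta l g \<theta> - dtheta l f \<theta>))"

text \<open>\<open>SUP\<close> over the reals is meaningful only for bounded sets; periodicity and
  continuity of the derivatives provide the bound.\<close>

lemma dtheta_diff_bdd:
  assumes "g \<in> Ck k" "f \<in> Ck k" "enat l \<le> k"
  shows "bdd_above (range (\<lambda>\<theta>. norm (dtheta l g \<theta> - dtheta l f \<theta>)))"
proof -
  obtain A B where "\<And>t. norm (dtheta l g t) \<le> A" "\<And>t. norm (dtheta l f t) \<le> B"
    using Ck_dtheta_bounded assms by metis
  then have "norm (dtheta l g t - dtheta l f t) \<le> A + B" for t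
    by (meson add_mono norm_triangle_ineq4 order_trans)
  then show ?thesis by (intro bdd_aboveI[of _ "A + B"]) auto
qed

lemma norm_le_sup_dist:
  assumes "g \<in> Ck k" "f \<in> Ck k" "enat l \<le> k"
  shows "norm (dtheta l g t - dtheta l f t) \<le> sup_dist l g f"
  unfolding sup_dist_def by (rule cSUP_upper[OF UNIV_I dtheta_diff_bdd[OF assms]])

lemma Ck_topology_alt:
  "Ck_topology k = subtopology
     (topology_generated_by {{g \<in> Ck k. sup_dist l g f < \<epsilon>} | f l \<epsilon>. f \<in> Ck k \<and> enat l \<le> k \<and> \<epsilon> > 0}) (Ck k)"
  unfolding Ck_topology_def sup_dist_def ..

lemma openin_sup_dist_ball:
  assumes "f \<in> Ck k" "enat l \<le> k" "\<epsilon> > 0"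
  shows "openin (Ck_topology k) {g \<in> Ck k. sup_dist l g f < \<epsilon>}"
proof -
  let ?S = "{{g \<in> Ck k. sup_dist l g f < \<epsilon>} | f l \<epsilon>. f \<in> Ck k \<and> enat l \<le> k \<and> \<epsilon> > 0}"
  have "{g \<in> Ck k. sup_dist l g f < \<epsilon>} \<in> ?S" using assms by blast
  then have "openin (topology_generated_by ?S) {g \<in> Ck k. sup_dist l g f < \<epsilon>}"
    by (rule topology_generated_by_Basis)
  then show ?thesis unfolding Ck_topology_alt openin_subtopology by blast
qed

lemma sup_dist_self: "sup_dist l f f = 0"
  by (simp add: sup_dist_def)

lemma topspace_Ck_topology: "topspace (Ck_topology k) = Ck k"
proof
  show "topspace (Ck_topology k) \<subseteq> Ck k" by (simp add: Ck_topology_alt)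
  show "Ck k \<subseteq> topspace (Ck_topology k)"
  proof
    fix f assume f: "f \<in> Ck k"
    then have "openin (Ck_topology k) {g \<in> Ck k. sup_dist 0 g f < 1}"
      by (intro openin_sup_dist_ball) (auto simp flip: zero_enat_def)
    then show "f \<in> topspace (Ck_topology k)" using f sup_dist_self[of 0 f] openin_subset by fastforce
  qed
qed

text \<open>Failure shows at a single index \<open>n\<close>, as a strict inequality for one
  functional that is continuous in the sup norm.\<close>

lemma openin_not_shift_bounded:
  "openin (Ck_topology k) {g \<in> Ck k. \<not> shift_bounded \<sigma> q m M g}"
proof (subst openin_subopen, intro ballI)
  fix f assume f: "f \<in> {g \<in> Ck k. \<not> shift_bounded \<sigma> q m M g}"
  define s where "s = 1 / (real m + 2)"
  have s: "s > 0" by (simp add: s_def)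
  let ?sh = "\<lambda>g::real\<Rightarrow>complex. (\<lambda>t. g (q + \<sigma> * t))"
  have cont: "continuous_on UNIV (?sh g)" if "g \<in> Ck k" for g
    by (rule continuous_on_compose2[OF Ck_continuous[OF that]]) (auto intro!: continuous_intros)
  obtain n where n: "norm (taylor2 n (?sh f)) * (1 + s) ^ n > M"
    using f by (auto simp: shift_bounded_def geometric_bound_def s_def not_le)
  define d where "d = norm (taylor2 n (?sh f)) * (1 + s) ^ n - M"
  \<comment> \<open>By \<open>norm_taylor2_le\<close>, a sup distance below this changes the
    weighted coefficient of index \<open>n\<close> by less than its excess \<open>d\<close> over
    \<open>M\<close>.\<close>
  define \<epsilon> where "\<epsilon> = d / (2 * pi * (1 + s) ^ n)"
  have \<epsilon>: "\<epsilon> > 0" "2 * pi * \<epsilon> * (1 + s) ^ n = d" using n s by (auto simp: \<epsilon>_def d_def)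
  have k0: "enat 0 \<le> k" by (simp flip: zero_enat_def)
  let ?T = "{g \<in> Ck k. sup_dist 0 g f < \<epsilon>}"
  have "\<not> shift_bounded \<sigma> q m M g" if g: "g \<in> ?T" for g
  proof -
    have fC: "f \<in> Ck k" "g \<in> Ck k" using f g by auto
    have "norm (f t - g t) \<le> sup_dist 0 g f" for t
      using norm_le_sup_dist[OF fC(2) fC(1) k0, of t] by (simp add: norm_minus_commute)
    then have "norm (taylor2 n (\<lambda>t. ?sh f t - ?sh g t)) \<le> 2 * pi * sup_dist 0 g f"
      using cont fC by (intro norm_taylor2_le continuous_intros) auto
    also have "\<dots> < 2 * pi * \<epsilon>" using g by simp
    finally have "norm (taylor2 n (\<lambda>t. ?sh f t - ?sh g t)) * (1 + s) ^ n < d"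
      using s \<epsilon>(2) by (metis mult_strict_right_mono zero_less_power add_pos_pos zero_less_one)
    moreover have "taylor2 n (?sh f) = taylor2 n (?sh g) + taylor2 n (\<lambda>t. ?sh f t - ?sh g t)"
      using taylor2_add[of "?sh g" "\<lambda>t. ?sh f t - ?sh g t" n 1] cont fC by (simp add: continuous_on_diff)
    then have "norm (taylor2 n (?sh f)) \<le> norm (taylor2 n (?sh g)) + norm (taylor2 n (\<lambda>t. ?sh f t - ?sh g t))"
      using norm_triangle_ineq by simp
    then have "norm (taylor2 n (?sh f)) * (1 + s) ^ n
       \<le> (norm (taylor2 n (?sh g)) + norm (taylor2 n (\<lambda>t. ?sh f t - ?sh g t))) * (1 + s) ^ n"
      using s by (intro mult_right_mono) auto
    ultimately have "M < norm (taylor2 n (?sh g)) * (1 + s) ^ n"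
      by (simp add: d_def distrib_right)
    then show ?thesis unfolding shift_bounded_def geometric_bound_def s_def[symmetric]
      using not_le by blast
  qed
  moreover have "openin (Ck_topology k) ?T" using f \<epsilon> k0 by (intro openin_sup_dist_ball) auto
  moreover have "f \<in> ?T" using f \<epsilon> by (simp add: sup_dist_self)
  ultimately show "\<exists>T. openin (Ck_topology k) T \<and> f \<in> T \<and> T \<subseteq> {g \<in> Ck k. \<not> shift_bounded \<sigma> q m M g}"
    by (intro exI[of _ ?T]) blast
qed

text \<open>All that density uses of the topology: a line through a point of an open set stays in
  the set for small parameters. The induction follows the generation of open sets; the generating
  balls may have any centre \<open>f0\<close>, so the slack \<open>d\<close> of \<open>f\<close>
  inside each is what counts.\<close>

lemma Ck_open_direction:
  assumes "openin (Ck_topology k) T" "f \<in> T" "h \<in> Ck k"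
  shows "\<exists>\<delta>>0. \<forall>t::real. \<bar>t\<bar> < \<delta> \<longrightarrow> (\<lambda>x. f x + of_real t * h x) \<in> T"
proof -
  let ?S = "{{g \<in> Ck k. sup_dist l g f < \<epsilon>} | f l \<epsilon>. f \<in> Ck k \<and> enat l \<le> k \<and> \<epsilon> > 0}"
  obtain T' where T': "generate_topology_on ?S T'" "T = T' \<inter> Ck k"
    using assms(1) unfolding Ck_topology_alt openin_subtopology openin_topology_generated_by_iff by blast
  have "f \<in> Ck k" "f \<in> T'" using assms T' by auto
  have "\<exists>\<delta>>0. \<forall>t::real. \<bar>t\<bar> < \<delta> \<longrightarrow> (\<lambda>x. f x + of_real t * h x) \<in> T'"
    using T'(1) \<open>f \<in> T'\<close>
  proof (induction rule: generate_topology_on.induct)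
    case (Int a b)
    then obtain \<delta>1 \<delta>2 where d: "\<delta>1 > 0" "\<delta>2 > 0"
      "\<And>t::real. \<bar>t\<bar> < \<delta>1 \<Longrightarrow> (\<lambda>x. f x + of_real t * h x) \<in> a"
      "\<And>t::real. \<bar>t\<bar> < \<delta>2 \<Longrightarrow> (\<lambda>x. f x + of_real t * h x) \<in> b" by auto
    then show ?case by (intro exI[of _ "min \<delta>1 \<delta>2"]) auto
  next
    case (UN K)
    then obtain a where a: "a \<in> K" "f \<in> a" by blast
    with UN.IH[OF a] show ?case by blast
  next
    case (Basis s)
    then obtain f0 l \<epsilon> where s: "s = {g \<in> Ck k. sup_dist l g f0 < \<epsilon>}" "f0 \<in> Ck k" "enat l \<le> k" by blast
    define d where "d = \<epsilon> - sup_dist l f f0"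
    have d: "d > 0" using Basis s by (simp add: d_def)
    obtain B where B: "0 < B" "\<And>t. norm (dtheta l h t) \<le> B"
      using Ck_dtheta_bounded[OF assms(3) s(3)] by blast
    have "(\<lambda>x. f x + of_real t * h x) \<in> s" if t: "\<bar>t\<bar> < d / (2 * B)" for t :: real
    proof -
      let ?g = "\<lambda>x. f x + of_real t * h x"
      have "\<bar>t\<bar> * B \<le> d / 2" using t B by (simp add: field_simps)
      have "norm (dtheta l ?g \<theta> - dtheta l f0 \<theta>) \<le> sup_dist l f f0 + d / 2" for \<theta>
      proof -
        have "dtheta l ?g \<theta> - dtheta l f0 \<theta> = (dtheta l f \<theta> - dtheta l f0 \<theta>) + of_real t * dtheta l h \<theta>"
          by (simp add: dtheta_add[OF \<open>f \<in> Ck k\<close> assms(3) s(3)])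
        also have "norm \<dots> \<le> norm (dtheta l f \<theta> - dtheta l f0 \<theta>) + \<bar>t\<bar> * norm (dtheta l h \<theta>)"
          by (metis norm_mult norm_of_real norm_triangle_ineq)
        also have "\<dots> \<le> sup_dist l f f0 + \<bar>t\<bar> * B"
          using B by (intro add_mono norm_le_sup_dist[OF \<open>f \<in> Ck k\<close> s(2,3)] mult_left_mono) auto
        finally show ?thesis using \<open>\<bar>t\<bar> * B \<le> d / 2\<close> by linarith
      qed
      then have "sup_dist l ?g f0 \<le> sup_dist l f f0 + d / 2"
        unfolding sup_dist_def[of l ?g] by (intro cSUP_least) auto
      also have "\<dots> < \<epsilon>" using d by (simp add: d_def field_simps)
      finally have "sup_dist l ?g f0 < \<epsilon>" .
      then show ?thesis using Ck_add[OF \<open>f \<in> Ck k\<close> assms(3)] s(1) by auto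
    qed
    then show ?case using d B by (intro exI[of _ "d / (2 * B)"]) auto
  qed simp
  then show ?thesis using T'(2) Ck_add[OF \<open>f \<in> Ck k\<close> assms(3)] by auto
qed

text \<open>The functions satisfying some bound form a linear space, so a line in a direction outside
  this space meets it at most once.\<close>

lemma shift_bounded_line:
  assumes f: "f \<in> Ck k" and h: "h \<in> Ck k"
    and t: "shift_bounded \<sigma> q m M (\<lambda>x. f x + of_real t * h x)"
    and t': "shift_bounded \<sigma> q m M' (\<lambda>x. f x + of_real t' * h x)" and "t \<noteq> t'"
  shows "\<exists>N. shift_bounded \<sigma> q m N h"
proof -
  define s where "s = 1 / (real m + 2)"
  have s: "s \<ge> 0" by (simp add: s_def)
  let ?sh = "\<lambda>g::real\<Rightarrow>complex. (\<lambda>t. g (q + \<sigma> * t))"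
  let ?A = "?sh (\<lambda>x. f x + of_real t * h x)" and ?B = "?sh (\<lambda>x. f x + of_real t' * h x)"
  have cont: "continuous_on UNIV (?sh g)" if "g \<in> Ck k" for g
    by (rule continuous_on_compose2[OF Ck_continuous[OF that]]) (auto intro!: continuous_intros)
  have AB: "continuous_on UNIV ?A" "continuous_on UNIV ?B"
    using cont[OF Ck_add[OF f h]] by auto
  have gA: "geometric_bound s M ?A" and gB: "geometric_bound s M' ?B"
    using t t' by (auto simp: shift_bounded_def s_def)
  have g0: "geometric_bound s 0 (\<lambda>_. 0)"
    by (simp add: geometric_bound_def taylor2_def)
  define c where "c = (1 / of_real (t - t') :: complex)"
  have "geometric_bound s (0 + norm c * (M + norm (-1 :: complex) * M')) (\<lambda>x. 0 + c * (?A x + (-1) * ?B x))"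
    using s by (intro geometric_bound_add gA gB g0 AB continuous_intros)
  also have "(\<lambda>x. 0 + c * (?A x + (-1) * ?B x)) = ?sh h"
  proof
    fix x
    have "?A x + (-1) * ?B x = of_real (t - t') * ?sh h x" by (simp add: algebra_simps)
    then show "0 + c * (?A x + (-1) * ?B x) = ?sh h x"
      using \<open>t \<noteq> t'\<close> unfolding c_def by simp
  qed
  finally have gb: "geometric_bound s (norm c * (M + M')) (?sh h)" by simp
  obtain N where "norm c * (M + M') \<le> real N" using real_arch_simple by blast
  then have "geometric_bound s N (?sh h)" using s by (intro geometric_bound_mono[OF gb]) auto
  then show ?thesis unfolding shift_bounded_def s_def by blast
qed

section \<open>A lacunary series without local extensions\<close>

text \<open>Non-negative frequencies are boundary values of polynomials, so Cauchy's theorem in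
  \<open>ball 0 2\<close> kills them; only negative frequencies reach the exterior
  transform.\<close>

lemma taylor2_cis_nonneg: "taylor2 n (\<lambda>t. cis (real N * t)) = 0"
proof -
  let ?f = "\<lambda>w::complex. w ^ N / (w - 2) ^ Suc n"
  have "(?f has_contour_integral 0) (part_circlepath 0 1 (-pi) pi)"
  proof (rule Cauchy_theorem_disc_simple)
    show "?f holomorphic_on ball 0 2" by (intro holomorphic_intros) auto
    show "path_image (part_circlepath 0 1 (-pi) pi) \<subseteq> ball 0 2"
      by (auto simp: path_image_part_circlepath' norm_mult)
    show "pathfinish (part_circlepath 0 1 (-pi) pi) = pathstart (part_circlepath 0 1 (-pi) pi)"
      by (simp flip: cis_conv_exp add: cis_minus_pi exp_minus mult.commute[of _ \<i>])
  qed auto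
  then have "((\<lambda>t. ?f (cis t) * \<i> * cis t) has_integral 0) {-pi..pi}"
    by (subst (asm) has_contour_integral_part_circlepath_iff) auto
  then have "((\<lambda>t. - \<i> * (?f (cis t) * \<i> * cis t)) has_integral - \<i> * 0) {-pi..pi}"
    by (rule has_integral_mult_right)
  moreover have "- \<i> * (?f (cis t) * \<i> * cis t) = cis (real N * t) * cis t / (cis t - 2) ^ Suc n" for t
  proof -
    have "- \<i> * (A * \<i> * c) = A * c" for A c :: complex by (simp add: complex_eq_iff)
    then show ?thesis by (simp add: Complex.DeMoivre del: power_Suc)
  qed
  ultimately show ?thesis unfolding taylor2_def
    by (simp add: integral_unique del: power_Suc)
qed

lemma integral_cis_nat: "integral {-pi..pi} (\<lambda>t. cis (- real (Suc N) * t)) = 0"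
proof -
  have "((\<lambda>t. cis (- real (Suc N) * t)) has_integral
     \<i> / Suc N * cis (- real (Suc N) * pi) - \<i> / Suc N * cis (- real (Suc N) * (- pi))) {-pi..pi}"
  proof (rule fundamental_theorem_of_calculus)
    show "((\<lambda>t. \<i> / Suc N * cis (- real (Suc N) * t)) has_vector_derivative cis (- real (Suc N) * t)) (at t within {-pi..pi})" for t
      unfolding cis_conv_exp of_real_mult
      by (rule has_vector_derivative_real_field) (auto intro!: derivative_eq_intros simp del: of_nat_Suc)
  qed auto
  moreover have "cis (- real (Suc N) * pi) = cis (- real (Suc N) * (- pi))"
    using sin_npi[of "Suc N"] by (simp add: complex_eq_iff del: of_nat_Suc sin_npi)
  ultimately show ?thesis by (simp add: integral_unique)
qed

text \<open>Write \<open>cis t = 2 + (cis t - 2)\<close>; the second summand lowers the exponent of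
  the denominator by one. At index 0 the denominator disappears and the bare integral
  remains.\<close>

lemma taylor2_shift:
  assumes "continuous_on UNIV \<phi>"
  shows "taylor2 (Suc n) (\<lambda>t. cis t * \<phi> t) = 2 * taylor2 (Suc n) \<phi> + taylor2 n \<phi>"
    and "taylor2 0 (\<lambda>t. cis t * \<phi> t) = 2 * taylor2 0 \<phi> + integral {-pi..pi} (\<lambda>t. \<phi> t * cis t)"
proof -
  have int: "(\<lambda>t. \<phi> t * cis t / (cis t - 2) ^ m) integrable_on {-pi..pi}" for m
    using assms by (intro taylor2_integrable) (auto intro: continuous_on_subset)
  have eq: "(cis t * \<phi> t) * cis t / (cis t - 2) ^ Suc m
     = 2 * (\<phi> t * cis t / (cis t - 2) ^ Suc m) + \<phi> t * cis t / (cis t - 2) ^ m" for m t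
  proof -
    have "\<phi> t * cis t / (cis t - 2) ^ m = \<phi> t * cis t * (cis t - 2) / (cis t - 2) ^ Suc m" by simp
    then show ?thesis by (simp add: add_divide_distrib diff_divide_distrib algebra_simps del: power_Suc)
  qed
  have "taylor2 m (\<lambda>t. cis t * \<phi> t) = 2 * taylor2 m \<phi> + integral {-pi..pi} (\<lambda>t. \<phi> t * cis t / (cis t - 2) ^ m)" for m
    unfolding taylor2_def eq
    by (subst integral_add[OF integrable_on_mult_right[OF int] int]) (simp only: integral_mult_right)
  note * = this
  show "taylor2 (Suc n) (\<lambda>t. cis t * \<phi> t) = 2 * taylor2 (Suc n) \<phi> + taylor2 n \<phi>"
    unfolding *[of "Suc n"] by (simp only: taylor2_def)
  show "taylor2 0 (\<lambda>t. cis t * \<phi> t) = 2 * taylor2 0 \<phi> + integral {-pi..pi} (\<lambda>t. \<phi> t * cis t)"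
    unfolding *[of 0] by simp
qed

lemma continuous_on_cis_mult: "continuous_on S (\<lambda>t. cis (c * t))"
  by (intro continuous_intros)

text \<open>The recursion of \<open>taylor2_shift\<close> is Pascal's rule.\<close>

lemma taylor2_cis_neg:
  "taylor2 n (\<lambda>t. cis (- real (Suc N) * t)) = of_real (2 * pi * (-1) ^ Suc n * real ((n + N) choose n) / 2 ^ (n + Suc N))"
proof -
  define T where "T n N = taylor2 n (\<lambda>t. cis (- real N * t))" for n N
  have T0: "T n 0 = 0" for n using taylor2_cis_nonneg[of n 0] by (simp add: T_def)
  have sh: "cis t * cis (- real (Suc N) * t) = cis (- real N * t)" for t N
    by (simp add: cis_mult algebra_simps)
  have S: "T (Suc n) (Suc N) = (T (Suc n) N - T n (Suc N)) / 2" for n N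
    using taylor2_shift(1)[OF continuous_on_cis_mult, of n "- real (Suc N)"] unfolding sh T_def by simp
  have S0: "T 0 (Suc N) = (T 0 N - integral {-pi..pi} (\<lambda>t. cis (- real N * t))) / 2" for N
    using taylor2_shift(2)[OF continuous_on_cis_mult, of "- real (Suc N)"]
    unfolding mult.commute[of "cis (- real (Suc N) * _)"] sh T_def by simp
  have "T n (Suc N) = of_real (2 * pi * (-1) ^ Suc n * real ((n + N) choose n) / 2 ^ (n + Suc N))"
  proof (induction n arbitrary: N)
    case 0
    show ?case
    proof (induction N)
      case 0
      show ?case using S0[of 0] T0 by (simp add: scaleR_conv_of_real)
    next
      case (Suc N)
      show ?case unfolding S0[of "Suc N"] Suc.IH integral_cis_nat by simp
    qed
  next
    case (Suc n)
    note IHn = Suc.IH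
    show ?case
    proof (induction N)
      case 0
      show ?case unfolding S T0 IHn by simp
    next
      case (Suc N)
      have "(Suc n + Suc N) choose Suc n = ((Suc n + N) choose Suc n) + ((n + Suc N) choose n)"
        by simp
      then show ?case unfolding S[of n "Suc N"] Suc.IH IHn
        by (simp add: field_simps)
    qed
  qed
  then show ?thesis by (simp add: T_def)
qed

text \<open>These are the Taylor coefficients at 2 of \<open>- pi / z ^ Suc N\<close>, a binomial
  series. Their sign depends on \<open>n\<close> but not on the frequency, so contributions of
  different frequencies cannot cancel.\<close>

lemma taylor2_cos:
  "taylor2 n (\<lambda>t. of_real (cos (real (Suc N) * t)))
     = of_real ((-1) ^ Suc n * (pi * real ((n + N) choose n) / 2 ^ (n + Suc N)))"
proof -
  have eq: "(\<lambda>t. of_real (cos (real (Suc N) * t))) =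
     (\<lambda>t. (0 + (1/2) * cis (real (Suc N) * t)) + (1/2) * cis (- real (Suc N) * t))"
    by (auto simp: complex_eq_iff simp del: of_nat_Suc)
  have "taylor2 n (\<lambda>t. of_real (cos (real (Suc N) * t)))
     = taylor2 n (\<lambda>_. 0) + (1/2) * taylor2 n (\<lambda>t. cis (real (Suc N) * t)) + (1/2) * taylor2 n (\<lambda>t. cis (- real (Suc N) * t))"
    unfolding eq
    by (subst taylor2_add taylor2_add, (intro continuous_intros)+)+ (rule refl)
  also have "\<dots> = of_real ((-1) ^ Suc n * (pi * real ((n + N) choose n) / 2 ^ (n + Suc N)))"
    unfolding taylor2_cis_nonneg taylor2_cis_neg by (simp add: taylor2_def)
  finally show ?thesis .
qed

text \<open>Index and frequency both equal to \<open>Suc n\<close> produce the binomial coefficient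
  on the left; the central one on the right has a standard lower bound.\<close>

lemma central_binomial_half: "2 * ((Suc n + n) choose Suc n) = (2 * Suc n) choose Suc n"
proof -
  have "2 * Suc n = Suc (Suc n + n)" by simp
  then have "(2 * Suc n) choose Suc n = ((Suc n + n) choose n) + ((Suc n + n) choose Suc n)"
    by (simp only: binomial_Suc_Suc)
  also have "(Suc n + n) choose n = (Suc n + n) choose (Suc n + n - n)"
    by (rule binomial_symmetric) simp
  also have "Suc n + n - n = Suc n" by (rule diff_add_inverse2)
  finally show ?thesis by (simp only: mult_2)
qed

lemma taylor2_uniform_limit:
  assumes F: "\<And>K. continuous_on UNIV (F K)" and lim: "uniform_limit UNIV F g sequentially"
  shows "(\<lambda>K. taylor2 n (F K)) \<longlonglongrightarrow> taylor2 n g"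
proof (rule tendstoI)
  fix e :: real assume e: "e > 0"
  have g: "continuous_on UNIV g" using uniform_limit_theorem[OF _ lim] F by auto
  have "\<forall>\<^sub>F K in sequentially. \<forall>x\<in>UNIV. dist (F K x) (g x) < e / (4 * pi)"
    using lim e by (intro uniform_limitD) auto
  then show "\<forall>\<^sub>F K in sequentially. dist (taylor2 n (F K)) (taylor2 n g) < e"
  proof eventually_elim
    case (elim K)
    have "norm (taylor2 n (\<lambda>t. F K t + (-1) * g t)) \<le> 2 * pi * (e / (4 * pi))"
      using elim by (intro norm_taylor2_le continuous_intros F g) (auto simp: dist_norm intro: less_imp_le)
    then show ?case using e taylor2_add[OF F g, of n K "-1"] by (simp add: dist_norm)
  qed
qed

text \<open>The \<open>l\<close>-th derivative of the series, the phase \<open>l * (pi / 2)\<close>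
  encoding repeated differentiation of the cosine. The weights decay faster than every power of the
  frequency \<open>2 ^ j\<close>, hence smoothness, but slower than every exponential in it, hence
  no extension.\<close>

definition lacunary :: "nat \<Rightarrow> real \<Rightarrow> real" where
  "lacunary l \<theta> = (\<Sum>j. (1/2) ^ j\<^sup>2 * (2 ^ j) ^ l * cos (2 ^ j * \<theta> + real l * (pi / 2)))"

lemma summable_lacunary: "summable (\<lambda>j. (1/2::real) ^ j\<^sup>2 * (2 ^ j) ^ l)"
proof (rule summable_comparison_test_ev)
  show "summable (\<lambda>j. (1/2::real) ^ j)" by (rule summable_geometric) simp
  show "\<forall>\<^sub>F j in sequentially. norm ((1/2::real) ^ j\<^sup>2 * (2 ^ j) ^ l) \<le> (1/2) ^ j"
    using eventually_ge_at_top[of "Suc l"]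
  proof eventually_elim
    case (elim j)
    then have "j * l + j \<le> j\<^sup>2" by (metis mult_Suc_right add.commute mult_le_mono2 power2_eq_square)
    then have "(1/2::real) ^ j\<^sup>2 \<le> (1/2) ^ (j * l + j)" by (intro power_decreasing) auto
    then have "(1/2::real) ^ j\<^sup>2 * (2 ^ j) ^ l \<le> (1/2) ^ (j * l + j) * (2 ^ j) ^ l"
      by (intro mult_right_mono) auto
    also have "\<dots> = (1/2) ^ j"
      by (simp add: power_add power_mult power_one_over)
    finally show ?case by simp
  qed
qed

lemma lacunary_term_bound: "norm ((1/2::real) ^ j\<^sup>2 * (2 ^ j) ^ l * cos x) \<le> (1/2) ^ j\<^sup>2 * (2 ^ j) ^ l"
  by (simp add: abs_mult mult_left_le)

lemma lacunary_summable: "summable (\<lambda>j. (1/2::real) ^ j\<^sup>2 * (2 ^ j) ^ l * cos (c j))"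
  by (rule summable_comparison_test'[OF summable_lacunary, of 0]) (rule lacunary_term_bound)

lemma DERIV_lacunary: "(lacunary l has_real_derivative lacunary (Suc l) x) (at x)"
  unfolding lacunary_def[abs_def]
proof (rule has_field_derivative_series'(2)[of UNIV _ _ 0])
  show "uniformly_convergent_on UNIV (\<lambda>n x. \<Sum>i<n. (1/2::real) ^ i\<^sup>2 * (2 ^ i) ^ Suc l * cos (2 ^ i * x + real (Suc l) * (pi / 2)))"
    by (rule Weierstrass_m_test'[OF lacunary_term_bound summable_lacunary])
  show "((\<lambda>\<theta>. (1/2::real) ^ n\<^sup>2 * (2 ^ n) ^ l * cos (2 ^ n * \<theta> + real l * (pi / 2))) has_real_derivative
      (1/2::real) ^ n\<^sup>2 * (2 ^ n) ^ Suc l * cos (2 ^ n * y + real (Suc l) * (pi / 2))) (at y within UNIV)" for n y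
  proof -
    have "cos (2 ^ n * y + real (Suc l) * (pi / 2)) = - sin (2 ^ n * y + real l * (pi / 2))"
      by (simp add: algebra_simps minus_sin_cos_eq add_divide_distrib)
    then show ?thesis by (auto intro!: derivative_eq_intros)
  qed
  show "summable (\<lambda>n. (1/2::real) ^ n\<^sup>2 * (2 ^ n) ^ l * cos (2 ^ n * 0 + real l * (pi / 2)))"
    by (rule lacunary_summable)
qed auto

abbreviation lac :: "real \<Rightarrow> complex" where
  "lac \<equiv> \<lambda>\<theta>. of_real (lacunary 0 \<theta>)"

lemma dtheta_lac: "dtheta l lac = (\<lambda>\<theta>. of_real (lacunary l \<theta>))"
proof (induction l)
  case (Suc l)
  show ?case unfolding dtheta.simps Suc.IH
    by (intro ext vector_derivative_at has_vector_derivative_of_real DERIV_lacunary)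
qed simp

lemma lac_in_Ck: "lac \<in> Ck k"
proof -
  have "lacunary 0 (\<theta> + 2 * pi) = lacunary 0 \<theta>" for \<theta>
  proof -
    have "cos (2 ^ j * (\<theta> + 2 * pi)) = cos (2 ^ j * \<theta>)" for j :: nat
      using cos_eq_periodic_intro[of "2 ^ j * (\<theta> + 2 * pi)" "2 ^ j * \<theta>" "2 ^ j"]
      by (simp add: algebra_simps)
    then show ?thesis by (simp add: lacunary_def)
  qed
  moreover have d: "(\<lambda>\<theta>. of_real (lacunary l \<theta>) :: complex) differentiable (at x)" for l x
    using has_vector_derivative_of_real[OF DERIV_lacunary] by (rule differentiableI_vector)
  moreover have "continuous_on UNIV (\<lambda>\<theta>. of_real (lacunary l \<theta>) :: complex)" for l
    unfolding continuous_on_eq_continuous_at[OF open_UNIV]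
    using d differentiable_imp_continuous_within by blast
  ultimately show ?thesis by (simp add: Ck_def dtheta_lac)
qed

text \<open>At a dyadic angle all but finitely many terms of the lacunary series have the same phase;
  the exceptional ones form a trigonometric polynomial, and the remaining Taylor coefficients
  cannot cancel.\<close>

lemma lac_not_shift_bounded:
  assumes \<sigma>: "\<sigma> = 1 \<or> \<sigma> = -1"
  shows "\<not> shift_bounded \<sigma> (dyadic_angle p J) m M lac"
proof
  assume bounded: "shift_bounded \<sigma> (dyadic_angle p J) m M lac"
  define s where "s = 1 / (real m + 2)"
  have s: "0 < s" "s < 1" by (auto simp: s_def)
  let ?q = "dyadic_angle p J"
  \<comment> \<open>Since cosine is even, \<open>\<sigma>\<close> can be moved from \<open>t\<close>
    into the phase.\<close>
  define \<beta> where "\<beta> j = \<sigma> * (2 ^ j * ?q)" for j :: nat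
  define a where "a j = (1/2::real) ^ j\<^sup>2" for j :: nat
  have a: "a j > 0" for j by (simp add: a_def)
  have phase: "cos (2 ^ j * (?q + \<sigma> * t)) = cos (\<beta> j + 2 ^ j * t)" for j t
    using \<sigma> cos_minus[of "2 ^ j * (?q + \<sigma> * t)"] by (auto simp: \<beta>_def algebra_simps)
  have phase0: "cos (\<beta> (j + J) + x) = cos x" for j x
  proof -
    have "2 ^ (j + J) * ?q = 2 * pi * of_int (p * 2 ^ j)"
      by (simp add: dyadic_angle_def power_add)
    then have "\<exists>k::int. \<beta> (j + J) = 2 * pi * of_int k"
      using \<sigma> by (auto simp: \<beta>_def simp del: of_int_mult intro: exI[of _ "p * 2 ^ j"] exI[of _ "- (p * 2 ^ j)"])
    then obtain k :: int where "\<beta> (j + J) = 2 * pi * of_int k" by blast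
    then show ?thesis using cos_eq_periodic_intro[of "\<beta> (j + J) + x" x k] by simp
  qed
  have suma: "summable (\<lambda>j. a j * cos (c j))" for c using lacunary_summable[of 0 c] by (simp add: a_def)
  define tail where "tail t = (\<Sum>j. a (j + J) * cos (2 ^ (j + J) * t))" for t
  define fin where "fin t = (\<Sum>j<J. a j * cos (\<beta> j + 2 ^ j * t))" for t
  have split: "lacunary 0 (?q + \<sigma> * t) = tail t + fin t" for t
  proof -
    have "lacunary 0 (?q + \<sigma> * t) = (\<Sum>j. a j * cos (\<beta> j + 2 ^ j * t))"
      by (simp add: lacunary_def a_def phase)
    also have "\<dots> = (\<Sum>j. a (j + J) * cos (\<beta> (j + J) + 2 ^ (j + J) * t)) + fin t"
      unfolding fin_def by (rule suminf_split_initial_segment[OF suma])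
    finally show ?thesis by (simp add: phase0 tail_def)
  qed
  \<comment> \<open>On the circle each cosine is a Laurent polynomial in \<open>z\<close>. As
    \<open>s < 1\<close>, 0 lies outside \<open>cap s\<close>, so the deformation lemma applies with
    this same \<open>s\<close>.\<close>
  have "\<exists>M. geometric_bound s M (\<lambda>t. of_real (fin t))"
  proof (rule extension_imp_geometric_bound[OF _ s, of _
      "\<lambda>z. \<Sum>j<J. of_real (a j) * ((cis (\<beta> j) * z ^ 2 ^ j + cis (- \<beta> j) * inverse z ^ 2 ^ j) / 2)"])
    have nz: "z \<noteq> 0" if "z \<in> cap s" for z using that s by (auto simp: cap_def)
    show "continuous_on (cap s) (\<lambda>z. \<Sum>j<J. of_real (a j) * ((cis (\<beta> j) * z ^ 2 ^ j + cis (- \<beta> j) * inverse z ^ 2 ^ j) / 2))"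
      using nz by (intro continuous_intros) auto
    show "(\<lambda>z. \<Sum>j<J. of_real (a j) * ((cis (\<beta> j) * z ^ 2 ^ j + cis (- \<beta> j) * inverse z ^ 2 ^ j) / 2)) holomorphic_on interior (cap s)"
      using nz interior_subset by (intro holomorphic_intros) auto
    show "continuous_on UNIV (\<lambda>t. of_real (fin t) :: complex)"
      unfolding fin_def by (intro continuous_intros)
    show "(\<Sum>j<J. of_real (a j) * ((cis (\<beta> j) * cis t ^ 2 ^ j + cis (- \<beta> j) * inverse (cis t) ^ 2 ^ j) / 2)) = of_real (fin t)" for t
    proof -
      have "(cis (\<beta> j) * cis t ^ 2 ^ j + cis (- \<beta> j) * inverse (cis t) ^ 2 ^ j) / 2 = of_real (cos (\<beta> j + 2 ^ j * t))" for j
        by (simp add: Complex.DeMoivre cis_inverse cis_mult complex_eq_iff cos_add sin_add cos_diff sin_diff)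
      then show ?thesis by (simp add: fin_def)
    qed
  qed
  then obtain M1 where M1: "geometric_bound s M1 (\<lambda>t. of_real (fin t))" by blast
  have contfin: "continuous_on UNIV (\<lambda>t. of_real (fin t) :: complex)"
    unfolding fin_def by (intro continuous_intros)
  have contlac: "continuous_on UNIV (\<lambda>t. lac (?q + \<sigma> * t))"
    by (rule continuous_on_compose2[OF Ck_continuous[OF lac_in_Ck[of 0]]]) (auto intro!: continuous_intros)
  have "geometric_bound s (M + norm (-1::complex) * M1) (\<lambda>t. lac (?q + \<sigma> * t) + (-1) * of_real (fin t))"
    using bounded s unfolding shift_bounded_def s_def[symmetric]
    by (intro geometric_bound_add contlac contfin M1) auto
  then obtain M2 where M2: "geometric_bound s M2 (\<lambda>t. of_real (tail t))" by (auto simp: split)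
  \<comment> \<open>Size of the contribution of frequency \<open>2 ^ (j + J)\<close> to the
    coefficient of index \<open>n\<close>; the \<open>- 1\<close> undoes the \<open>Suc N\<close> of
    \<open>taylor2_cos\<close>.\<close>
  define b where "b n j = a (j + J) * (pi * real ((n + (2 ^ (j + J) - 1)) choose n) / 2 ^ (n + 2 ^ (j + J)))" for n j
  have b0: "b n j \<ge> 0" for n j using less_imp_le[OF a] by (simp add: b_def)
  have coef: "(\<lambda>j. of_real ((-1) ^ Suc n * b n j)) sums taylor2 n (\<lambda>t. of_real (tail t))" for n
  proof -
    let ?c = "\<lambda>j t. of_real (cos (2 ^ (j + J) * t)) :: complex"
    have contc: "continuous_on UNIV (\<lambda>t. \<Sum>j<K. of_real (a (j + J)) * ?c j t)" for K
      by (intro continuous_intros)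
    have part: "taylor2 n (\<lambda>t. \<Sum>j<K. of_real (a (j + J)) * ?c j t) = (\<Sum>j<K. of_real ((-1) ^ Suc n * b n j))" for K
    proof (induction K)
      case 0
      show ?case by (simp add: taylor2_def)
    next
      case (Suc K)
      have "taylor2 n (?c K) = of_real ((-1) ^ Suc n * (pi * real ((n + (2 ^ (K + J) - 1)) choose n) / 2 ^ (n + 2 ^ (K + J))))"
        using taylor2_cos[of n "2 ^ (K + J) - 1"] by simp
      moreover have "taylor2 n (\<lambda>t. (\<Sum>j<K. of_real (a (j + J)) * ?c j t) + of_real (a (K + J)) * ?c K t)
         = taylor2 n (\<lambda>t. \<Sum>j<K. of_real (a (j + J)) * ?c j t) + of_real (a (K + J)) * taylor2 n (?c K)"
        by (intro taylor2_add contc continuous_intros)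
      ultimately show ?case using Suc.IH by (simp add: b_def)
    qed
    have "uniform_limit UNIV (\<lambda>K t. \<Sum>j<K. a (j + J) * cos (2 ^ (j + J) * t)) tail sequentially"
      unfolding tail_def[abs_def]
    proof (rule Weierstrass_m_test)
      show "summable (\<lambda>j. a (j + J))"
        using summable_ignore_initial_segment[OF summable_lacunary[of 0]] by (simp add: a_def)
      show "norm (a (j + J) * cos (2 ^ (j + J) * t)) \<le> a (j + J)" for j t
        using lacunary_term_bound[of "j + J" 0] by (simp add: a_def)
    qed
    then have "uniform_limit UNIV (\<lambda>K t. \<Sum>j<K. of_real (a (j + J)) * ?c j t) (\<lambda>t. of_real (tail t)) sequentially"
      unfolding uniform_limit_iff by (simp add: dist_of_real flip: of_real_mult of_real_sum)
    then show ?thesis unfolding sums_def part[symmetric] by (rule taylor2_uniform_limit[OF contc])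
  qed
  \<comment> \<open>All contributions to index \<open>n\<close> share the sign
    \<open>(-1) ^ Suc n\<close>, so any single one is a lower bound for the whole.\<close>
  have lower: "b n j \<le> norm (taylor2 n (\<lambda>t. of_real (tail t)))" for n j
  proof -
    have "(\<lambda>j. Re ((-1) ^ Suc n * of_real ((-1) ^ Suc n * b n j))) sums Re ((-1) ^ Suc n * taylor2 n (\<lambda>t. of_real (tail t)))"
      by (intro sums_Re sums_mult coef)
    moreover have "Re ((-1) ^ Suc n * of_real ((-1) ^ Suc n * b n j)) = b n j" for j
      by (cases "even n") auto
    ultimately have sm: "b n sums Re ((-1) ^ Suc n * taylor2 n (\<lambda>t. of_real (tail t)))" by (simp only:)
    have "b n j = sum (b n) {j}" by simp
    also have "\<dots> \<le> suminf (b n)"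
      using sm b0 by (intro sum_le_suminf) (auto simp: sums_iff)
    also have "\<dots> = Re ((-1) ^ Suc n * taylor2 n (\<lambda>t. of_real (tail t)))" using sm by (simp add: sums_iff)
    also have "\<dots> \<le> norm ((-1) ^ Suc n * taylor2 n (\<lambda>t. of_real (tail t)))" by (rule complex_Re_le_cmod)
    also have "\<dots> = norm (taylor2 n (\<lambda>t. of_real (tail t)))" by (simp add: norm_mult norm_power)
    finally show ?thesis .
  qed
  have "(1/2) ^ j\<^sup>2 * (pi / (4 * 2 ^ j)) * (1 + s) ^ (2 ^ j) \<le> M2" if "j \<ge> J" for j
  proof -
    \<comment> \<open>Taking the index equal to the frequency \<open>N\<close>, the binomial
      coefficient is at least \<open>4 ^ N / (4 * N)\<close>. This cancels
      \<open>2 ^ (N + N)\<close> up to the factor \<open>4 * N\<close>, so essentially only the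
      weight is lost.\<close>
    define N :: nat where "N = 2 ^ j"
    have N: "N > 0" by (simp add: N_def)
    define i where "i = j - J"
    have i: "j = i + J" using that by (simp add: i_def)
    define N' where "N' = N - 1"
    have N': "N = Suc N'" using N by (simp add: N'_def)
    have binom: "2 * ((N + (N - 1)) choose N) = (2 * N) choose N"
      using central_binomial_half[of N'] unfolding N' by (simp only: diff_Suc_1)
    have "4 ^ N / (2 * real N) \<le> real ((2 * N) choose N)" by (rule central_binomial_lower_bound[OF N])
    also have "\<dots> = 2 * real ((N + (N - 1)) choose N)" by (simp flip: binom)
    finally have "4 ^ N / (4 * real N) \<le> real ((N + (N - 1)) choose N)" by simp
    then have "pi * (4 ^ N / (4 * real N)) / 2 ^ (N + N) \<le> pi * real ((N + (N - 1)) choose N) / 2 ^ (N + N)"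
      by (intro divide_right_mono mult_left_mono) auto
    moreover have "pi * (4 ^ N / (4 * real N)) / 2 ^ (N + N) = pi / (4 * 2 ^ j)"
      by (simp add: N_def power_add flip: power_mult_distrib)
    ultimately have "a j * (pi / (4 * 2 ^ j)) \<le> a j * (pi * real ((N + (N - 1)) choose N) / 2 ^ (N + N))"
      using less_imp_le[OF a] by (intro mult_left_mono) auto
    also have "\<dots> = b N i" by (simp add: b_def i N_def)
    also have "\<dots> \<le> norm (taylor2 N (\<lambda>t. of_real (tail t)))" by (rule lower)
    finally have "a j * (pi / (4 * 2 ^ j)) * (1 + s) ^ N \<le> norm (taylor2 N (\<lambda>t. of_real (tail t))) * (1 + s) ^ N"
      using s by (intro mult_right_mono) auto
    also have "\<dots> \<le> M2" using M2 by (auto simp: geometric_bound_def)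
    finally show ?thesis by (simp add: a_def N_def)
  qed
  then have "\<forall>\<^sub>F j in sequentially. (1/2) ^ j\<^sup>2 * (pi / (4 * 2 ^ j)) * (1 + s) ^ (2 ^ j) \<le> M2"
    using eventually_ge_at_top[of J] by (rule eventually_mono[rotated])
  \<comment> \<open>The losses are exponential in \<open>j\<^sup>2\<close> only, the gain
    \<open>(1 + s) ^ (2 ^ j)\<close> is doubly exponential in \<open>j\<close>.\<close>
  moreover have "filterlim (\<lambda>j::nat. (1/2) ^ j\<^sup>2 * (pi / (4 * 2 ^ j)) * (1 + s) ^ (2 ^ j)) at_top sequentially"
    using s(1) by real_asymp
  then have "\<forall>\<^sub>F j in sequentially. (1/2) ^ j\<^sup>2 * (pi / (4 * 2 ^ j)) * (1 + s) ^ (2 ^ j) > M2"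
    by (simp add: filterlim_at_top_dense)
  ultimately have "\<forall>\<^sub>F j::nat in sequentially. False" by eventually_elim simp
  then show False by simp
qed

section \<open>Genericity\<close>

text \<open>The circle is nonempty, so the condition \<open>g \<in> Ck k\<close> survives the
  rewriting of the intersection.\<close>

lemma U3_eq: "U3 k = {g \<in> Ck k. \<not> (\<exists>z0\<in>sphere 0 1. extends_inside z0 g)}"
proof -
  have "(1::complex) \<in> sphere 0 1" by simp
  then show ?thesis unfolding U3_def U3_at_def extends_inside_def by blast
qed

lemma U2_eq: "U2 k = {g \<in> Ck k. \<not> (\<exists>z0\<in>sphere 0 1. extends_outside z0 g)}"
proof -
  have "(1::complex) \<in> sphere 0 1" by simp
  then show ?thesis unfolding U2_def U2_at_def extends_outside_def by blast
qed

lemma U5_eq: "U5 k = {g \<in> Ck k. \<not> (\<exists>z0\<in>sphere 0 1. extends_across z0 g)}"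
proof -
  have "(1::complex) \<in> sphere 0 1" by simp
  then show ?thesis unfolding U5_def U5_at_def extends_across_def by blast
qed

lemma U4_eq: "U4 k = U2 k \<inter> U3 k"
  unfolding U4_def U4_at_def U2_def U3_def by auto

lemma U3_eq_Inter:
  "U3 k = (\<Inter>(p, j, m, M). {g \<in> Ck k. \<not> shift_bounded 1 (dyadic_angle p j) m M g})"
proof -
  have "U3 k = {g \<in> Ck k. \<not> (\<exists>p j m M. shift_bounded 1 (dyadic_angle p j) m M g)}"
    unfolding U3_eq
    by (intro Collect_cong conj_cong refl arg_cong[where f = Not]
        somewhere_inside_iff Ck_continuous[where k = k] Ck_periodic[where k = k])
  then show ?thesis by auto
qed

lemma U2_eq_Inter:
  "U2 k = (\<Inter>(p, j, m, M). {g \<in> Ck k. \<not> shift_bounded (-1) (dyadic_angle p j) m M g})"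
proof -
  have "U2 k = {g \<in> Ck k. \<not> (\<exists>p j m M. shift_bounded (-1) (dyadic_angle p j) m M g)}"
    unfolding U2_eq
    by (intro Collect_cong conj_cong refl arg_cong[where f = Not]
        somewhere_outside_iff Ck_continuous[where k = k] Ck_periodic[where k = k])
  then show ?thesis by auto
qed

text \<open>Not extending across means failing on at least one side, so each index gives a union of
  two open sets. The sides share the dyadic point but have separate constants.\<close>

lemma U5_eq_Inter:
  "U5 k = (\<Inter>(p, j, m, M, m', M'). {g \<in> Ck k. \<not> shift_bounded 1 (dyadic_angle p j) m M g}
      \<union> {g \<in> Ck k. \<not> shift_bounded (-1) (dyadic_angle p j) m' M' g})"
proof -
  have "U5 k = {g \<in> Ck k. \<not> (\<exists>p j m M m' M'. shift_bounded 1 (dyadic_angle p j) m M g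
      \<and> shift_bounded (-1) (dyadic_angle p j) m' M' g)}"
    unfolding U5_eq
    by (intro Collect_cong conj_cong refl arg_cong[where f = Not]
        somewhere_across_iff Ck_continuous[where k = k] Ck_periodic[where k = k])
  then show ?thesis by (simp only:) blast
qed

lemma gdelta_in_INT_countable:
  fixes A :: "'i::countable \<Rightarrow> 'a set"
  assumes "\<And>i. openin X (A i)"
  shows "gdelta_in X (\<Inter>i. A i)"
  using assms by (intro gdelta_in_Inter) (auto intro: open_imp_gdelta_in)

lemma gdelta_U3: "gdelta_in (Ck_topology k) (U3 k)"
  unfolding U3_eq_Inter by (rule gdelta_in_INT_countable) (auto intro: openin_not_shift_bounded)

lemma gdelta_U2: "gdelta_in (Ck_topology k) (U2 k)"
  unfolding U2_eq_Inter by (rule gdelta_in_INT_countable) (auto intro: openin_not_shift_bounded)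

lemma gdelta_U5: "gdelta_in (Ck_topology k) (U5 k)"
  unfolding U5_eq_Inter
  by (rule gdelta_in_INT_countable) (auto intro!: openin_Un openin_not_shift_bounded split: prod.split)

lemma U4_subset_U5: "U4 k \<subseteq> U5 k"
  unfolding U4_eq U2_eq_Inter U3_eq_Inter U5_eq_Inter by blast

lemma dense_U4: "Ck_topology k closure_of U4 k = topspace (Ck_topology k)"
  unfolding dense_intersects_open
proof (intro allI impI, elim conjE)
  fix T assume T: "openin (Ck_topology k) T" "T \<noteq> {}"
  then obtain f where f: "f \<in> T" by blast
  then have fC: "f \<in> Ck k" using openin_subset[OF T(1)] by (auto simp: topspace_Ck_topology)
  obtain \<delta> where \<delta>: "\<delta> > 0" "\<And>t::real. \<bar>t\<bar> < \<delta> \<Longrightarrow> (\<lambda>x. f x + of_real t * lac x) \<in> T"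
    using Ck_open_direction[OF T(1) f lac_in_Ck] by blast
  \<comment> \<open>\<open>m\<close> is fixed and \<open>M\<close> left free, since only then do the
    bounded functions form a linear space. By \<open>shift_bounded_line\<close> each such parameter
    set has at most one element.\<close>
  define bad where "bad \<sigma> p j m = {t::real. \<exists>M. shift_bounded \<sigma> (dyadic_angle p j) m M (\<lambda>x. f x + of_real t * lac x)}" for \<sigma> p j m
  have one: "t = t'" if "t \<in> bad \<sigma> p j m" "t' \<in> bad \<sigma> p j m" "\<sigma> = 1 \<or> \<sigma> = -1" for \<sigma> p j m t t'
    using shift_bounded_line[OF fC lac_in_Ck] lac_not_shift_bounded[OF that(3)] that(1,2)
    unfolding bad_def by blast
  have "countable (bad \<sigma> p j m)" if "\<sigma> = 1 \<or> \<sigma> = -1" for \<sigma> p j m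
  proof (cases "bad \<sigma> p j m = {}")
    case False
    then obtain t where "t \<in> bad \<sigma> p j m" by blast
    then have "bad \<sigma> p j m \<subseteq> {t}" using one that by blast
    then show ?thesis using countable_subset by blast
  qed simp
  then have "countable (\<Union>p. \<Union>j. \<Union>m. bad 1 p j m \<union> bad (-1) p j m)" by (intro countable_UN) auto
  moreover have "uncountable {0<..<\<delta>}" using \<delta>(1) by (simp add: uncountable_open_interval)
  ultimately obtain t where t: "t \<in> {0<..<\<delta>}" "t \<notin> (\<Union>p. \<Union>j. \<Union>m. bad 1 p j m \<union> bad (-1) p j m)"
    by (meson countable_subset subsetI)
  let ?g = "\<lambda>x. f x + of_real t * lac x"
  have "?g \<in> T" using t(1) \<delta>(2) by auto
  moreover have "?g \<in> U4 k"
    unfolding U4_eq U2_eq_Inter U3_eq_Inter using t(2) Ck_add[OF fC lac_in_Ck] by (auto simp: bad_def)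
  ultimately show "U4 k \<inter> T \<noteq> {}" by blast
qed

text \<open>All four classes contain \<open>U4\<close>, so its density settles the density of
  each.\<close>

lemma dense_gdelta_if_U4_subset:
  assumes "gdelta_in (Ck_topology k) S" "U4 k \<subseteq> S"
  shows "dense_gdelta_in (Ck_topology k) S"
  unfolding dense_gdelta_in_def
  using assms dense_U4[of k] closure_of_mono[OF assms(2), of "Ck_topology k"] closure_of_subset_topspace[of "Ck_topology k" S]
  by blast

theorem theorem3p18:
  fixes k :: enat
  shows "dense_gdelta_in (Ck_topology k) (U2 k)
       \<and> dense_gdelta_in (Ck_topology k) (U3 k)
       \<and> dense_gdelta_in (Ck_topology k) (U4 k)
       \<and> dense_gdelta_in (Ck_topology k) (U5 k)"
  using gdelta_U2 gdelta_U3 gdelta_U5 U4_subset_U5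
  by (intro conjI dense_gdelta_if_U4_subset) (auto simp: U4_eq intro: gdelta_in_Int)

end
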